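(* Let $X$ be a Fréchet sequence space, endowed with an increasing sequence $(\|\cdot\|_n)_{n\in\mathbb{N}}$ of seminorms, in which the sequence $(e_n)_{n\in\mathbb{N}}$ of canonical vectors is a basis. Suppose that the unilateral weighted backward shift $B_w$, with nonzero weights $w:=(w_n)_{n\in\mathbb{N}}$, is well-defined and continuous on $X$. Then $B_w$ is distributionally chaotic if and only if the following condition holds: There exist $m\in\mathbb{N}$ and an increasing sequence $(N_k)_{k\in\mathbb{N}}$ of positive integers such that for each $k\in\mathbb{N}$ there are $r:=r(k)\in\mathbb{N}$, indices $i_{1,k},\dots,i_{r,k}\in\mathbb{N}$ and scalars $b_{1,k},\dots,b_{r,k}\in\mathbb{K}\setminus\{0\}$ with $\left\|\sum_{j=1}^{r}b_{j,k}e_{i_{j,k}}\right\|_{p(k)}\neq 0$ and $$\operatorname{card}\left\{1\le n\le N_k:\frac{\left\|\sum_{j=1}^{r}b_{j,k}w_{i_{j,k}-n}\cdots w_{i_{j,k}-1}e_{i_{j,k}-n}\right\|_{m}}{\left\|\sum_{j=1}^{r}b_{j,k}e_{i_{j,k}}\right\|_{p(k)}}>k\right\}>(1-k^{-1})N_k,$$ where $p(k):=m$ if $1\le k\le m$, and $p(k):=k$ if $k>m$. Here we put $e_k=(0)_{j\in\mathbb{N}}$ (the zero sequence) and $w_k=0$ for $k<1$.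
   Context: $\mathbb{K}$ is $\mathbb{R}$ or $\mathbb{C}$; $\mathbb{N}=\{1,2,3,\dots\}$. A Fréchet space is a vector space $X$ over $\mathbb{K}$ endowed with an increasing sequence $(\|\cdot\|_k)_{k\in\mathbb{N}}$ of seminorms such that $d(x,y):=\sum_{k=1}^{\infty}2^{-k}\min\{1,\|x-y\|_k\}$ is a metric under which $X$ is complete; $X$ is always considered with this metric $d$. A Fréchet sequence space is a Fréchet space $X$ that is a vector subspace of $\mathbb{K}^{\mathbb{N}}$ such that the inclusion $X\to\mathbb{K}^{\mathbb{N}}$ is continuous (convergence in $X$ implies coordinatewise convergence). The canonical vectors $e_n:=(\delta_{n,j})_{j\in\mathbb{N}}$, $n\in\mathbb{N}$, form a basis of $X$ if they belong to $X$ and $x=\sum_{n=1}^{\infty}x_ne_n$ in $X$ for every $x=(x_n)_{n\in\mathbb{N}}\in X$. For a sequence $w=(w_n)_{n\in\mathbb{N}}$ of nonzero scalars, the unilateral weighted backward shift is $B_w(x_1,x_2,x_3,\dots):=(w_1x_2,w_2x_3,w_3x_4,\dots)$; it is well-defined on $X$ if it maps $X$ into itself. A map $f:M\to M$ on a metric space $(M,d)$ is distributionally chaotic if there exist an uncountable set $\Gamma\subset M$ and $\varepsilon>0$ such that for each pair $(x,y)$ of distinct points of $\Gamma$, $$\liminf_{k\to\infty}\frac{\operatorname{card}\{n\in\{1,\dots,k\}:d(f^n(x),f^n(y))<\varepsilon\}}{k}=0$$ and, for all $\tau>0$, $$\limsup_{k\to\infty}\frac{\operatorname{card}\{n\in\{1,\dots,k\}:d(f^n(x),f^n(y))<\tau\}}{k}=1.$$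 *)

theory Defs
  imports "HOL-Analysis.Analysis" "HOL-Library.Function_Algebras"
begin

text \<open>
  The scalar field is a type of sort \<open>{real_normed_field, banach}\<close>. By the Gelfand-Mazur
  theorem such a field is isometrically isomorphic to the reals or to the complex numbers, and
  both \<open>real\<close> and \<open>complex\<close> are instances.

  Every sequence indexed by the positive integers is a function on \<open>nat\<close>. For scalar sequences
  the value at \<open>0\<close> is fixed to be \<open>0\<close>, so that \<open>scalar_seqs\<close> represents the space of all scalar
  sequences faithfully, and the addition, subtraction and zero sequence are those of
  \<open>HOL-Library.Function_Algebras\<close>. For sequences of seminorms the entry at \<open>0\<close> is never used.
\<close>

definition scalar_seqs :: "(nat \<Rightarrow> 'a::zero) set" where
  "scalar_seqs = {x. x 0 = 0}"

definition seq_scale :: "'a::times \<Rightarrow> (nat \<Rightarrow> 'a) \<Rightarrow> (nat \<Rightarrow> 'a)" where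
  "seq_scale c x = (\<lambda>j. c * x j)"

text \<open>With truncated subtraction, \<open>canonical_vec (i - n)\<close> is the zero sequence for \<open>n \<ge> i\<close>.\<close>

definition canonical_vec :: "nat \<Rightarrow> nat \<Rightarrow> 'a::zero_neq_one" where
  "canonical_vec n = (\<lambda>j. if 1 \<le> n \<and> j = n then 1 else 0)"

definition seminorm_on ::
    "('a::real_normed_field \<Rightarrow> 'b::ab_group_add \<Rightarrow> 'b) \<Rightarrow> 'b set \<Rightarrow> ('b \<Rightarrow> real) \<Rightarrow> bool" where
  "seminorm_on smul X q \<longleftrightarrow>
     (\<forall>x\<in>X. 0 \<le> q x) \<and>
     (\<forall>x\<in>X. \<forall>y\<in>X. q (x + y) \<le> q x + q y) \<and>
     (\<forall>c. \<forall>x\<in>X. q (smul c x) = norm c * q x)"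

text \<open>
  The locale \<open>Metric_space\<close> requires symmetry and nonnegativity on the whole type, hence the
  value \<open>0\<close> outside of \<open>X\<close>.
\<close>

definition frechet_dist ::
    "'b::ab_group_add set \<Rightarrow> (nat \<Rightarrow> 'b \<Rightarrow> real) \<Rightarrow> 'b \<Rightarrow> 'b \<Rightarrow> real" where
  "frechet_dist X p x y =
     (if x \<in> X \<and> y \<in> X then (\<Sum>k. (1/2) ^ Suc k * min 1 (p (Suc k) (x - y))) else 0)"

definition frechet_space ::
    "('a::{real_normed_field,banach} \<Rightarrow> 'b::ab_group_add \<Rightarrow> 'b) \<Rightarrow> 'b set \<Rightarrow>
     (nat \<Rightarrow> 'b \<Rightarrow> real) \<Rightarrow> bool" where
  "frechet_space smul X p \<longleftrightarrow>
     vector_space smul \<and> module.subspace smul X \<and>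
     (\<forall>k\<ge>1. seminorm_on smul X (p k)) \<and>
     (\<forall>k\<ge>1. \<forall>x\<in>X. p k x \<le> p (Suc k) x) \<and>
     Metric_space X (frechet_dist X p) \<and>
     Metric_space.mcomplete X (frechet_dist X p)"

definition frechet_topology ::
    "'b::ab_group_add set \<Rightarrow> (nat \<Rightarrow> 'b \<Rightarrow> real) \<Rightarrow> 'b topology" where
  "frechet_topology X p = Metric_space.mtopology X (frechet_dist X p)"

text \<open>The topology \<open>euclidean\<close> on \<open>nat \<Rightarrow> 'a\<close> is the product topology.\<close>

definition frechet_seq_space ::
    "(nat \<Rightarrow> 'a::{real_normed_field,banach}) set \<Rightarrow> (nat \<Rightarrow> (nat \<Rightarrow> 'a) \<Rightarrow> real) \<Rightarrow> bool" where
  "frechet_seq_space X p \<longleftrightarrow>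
     X \<subseteq> scalar_seqs \<and> frechet_space seq_scale X p \<and>
     continuous_map (frechet_topology X p) euclidean (\<lambda>x. x)"

definition canonical_basis ::
    "(nat \<Rightarrow> 'a::{real_normed_field,banach}) set \<Rightarrow> (nat \<Rightarrow> (nat \<Rightarrow> 'a) \<Rightarrow> real) \<Rightarrow> bool" where
  "canonical_basis X p \<longleftrightarrow>
     (\<forall>n\<ge>1. canonical_vec n \<in> X) \<and>
     (\<forall>x\<in>X. limitin (frechet_topology X p)
        (\<lambda>N. \<Sum>n=1..N. seq_scale (x n) (canonical_vec n)) x sequentially)"

text \<open>For \<open>w 0 = 0\<close> the values of the shift lie in \<open>scalar_seqs\<close>.\<close>

definition weighted_shift :: "(nat \<Rightarrow> 'a::times) \<Rightarrow> (nat \<Rightarrow> 'a) \<Rightarrow> (nat \<Rightarrow> 'a)" where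
  "weighted_shift w x = (\<lambda>n. w n * x (Suc n))"

text \<open>
  Since \<open>liminf\<close> and \<open>limsup\<close> need a complete lattice, the densities are taken in \<open>ereal\<close>.
\<close>

definition distributionally_chaotic ::
    "'b set \<Rightarrow> ('b \<Rightarrow> 'b \<Rightarrow> real) \<Rightarrow> ('b \<Rightarrow> 'b) \<Rightarrow> bool" where
  "distributionally_chaotic M d f \<longleftrightarrow>
     (\<exists>\<Gamma>\<subseteq>M. \<exists>\<epsilon>>0. uncountable \<Gamma> \<and>
       (\<forall>x\<in>\<Gamma>. \<forall>y\<in>\<Gamma>. x \<noteq> y \<longrightarrow>
          liminf (\<lambda>k. ereal (real (card {n\<in>{1..k}. d ((f ^^ n) x) ((f ^^ n) y) < \<epsilon>}) / real k)) = 0 \<and>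
          (\<forall>\<tau>>0. limsup (\<lambda>k. ereal (real (card {n\<in>{1..k}. d ((f ^^ n) x) ((f ^^ n) y) < \<tau>}) / real k)) = 1)))"

end

theory Submission
  imports Defs
begin

text \<open>
  Suppose the shift is distributionally chaotic and let \<open>u\<close> be the difference of two points of
  the scrambled set. Some seminorm \<open>p m\<close> of the orbit of \<open>u\<close> stays above a fixed \<open>\<delta>\<close> along
  times of upper density one, while the orbit also comes arbitrarily close to \<open>0\<close>. Starting from an
  iterate of \<open>u\<close> very close to \<open>0\<close> yields a vector \<open>z\<close> whose orbit is much larger than \<open>p l z\<close>
  most of the time up to some \<open>N\<close>; as only finitely many times are involved, \<open>z\<close> may be truncated
  to a finite combination of canonical vectors.

  Conversely, the orbits of finite combinations end in \<open>0\<close>. Scaled suitably, the given vectors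
  are summed to \<open>x = u 0 + u 1 + \<dots>\<close>, where \<open>u (j + 1)\<close> is so small that its orbit is
  negligible long after those of \<open>u 0, \<dots>, u j\<close> have died, and is later large for a time that
  dwarfs everything before. The orbit of \<open>x\<close> is thus small, respectively large, along times of
  upper density one, and the real line spanned by \<open>x\<close> is a scrambled set.
\<close>

subsection \<open>Densities\<close>

lemma limsup_ereal_eq_1_iff:
  fixes a :: "nat \<Rightarrow> real"
  assumes "\<And>k. a k \<le> 1"
  shows "limsup (\<lambda>k. ereal (a k)) = 1 \<longleftrightarrow> (\<forall>c<1. \<forall>K. \<exists>k\<ge>K. c < a k)"
proof
  assume lim: "limsup (\<lambda>k. ereal (a k)) = 1"
  show "\<forall>c<1. \<forall>K. \<exists>k\<ge>K. c < a k"
  proof (intro allI impI, rule ccontr)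
    fix c :: real and K assume "c < 1" and no: "\<not> (\<exists>k\<ge>K. c < a k)"
    have "limsup (\<lambda>k. ereal (a k)) \<le> ereal c"
      using no by (intro Limsup_bounded) (auto simp: eventually_sequentially not_less)
    then show False using lim \<open>c < 1\<close> by simp
  qed
next
  assume freq: "\<forall>c<1. \<forall>K. \<exists>k\<ge>K. c < a k"
  have "limsup (\<lambda>k. ereal (a k)) \<le> 1"
    using assms by (intro Limsup_bounded) auto
  moreover have "\<not> limsup (\<lambda>k. ereal (a k)) < 1"
  proof
    assume "limsup (\<lambda>k. ereal (a k)) < 1"
    then obtain c where c: "limsup (\<lambda>k. ereal (a k)) < ereal c" "ereal c < 1"
      using ereal_dense2 by blast
    then obtain K where "\<forall>k\<ge>K. a k < c"
      using Limsup_lessD[OF c(1)] by (auto simp: eventually_sequentially)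
    moreover from c(2) freq obtain k where "k \<ge> K" "c < a k" by (auto simp: one_ereal_def)
    ultimately show False by force
  qed
  ultimately show "limsup (\<lambda>k. ereal (a k)) = 1" by simp
qed

lemma liminf_ereal_eq_0_iff:
  fixes a :: "nat \<Rightarrow> real"
  assumes "\<And>k. 0 \<le> a k"
  shows "liminf (\<lambda>k. ereal (a k)) = 0 \<longleftrightarrow> (\<forall>c>0. \<forall>K. \<exists>k\<ge>K. a k < c)"
proof
  assume lim: "liminf (\<lambda>k. ereal (a k)) = 0"
  show "\<forall>c>0. \<forall>K. \<exists>k\<ge>K. a k < c"
  proof (intro allI impI, rule ccontr)
    fix c :: real and K assume "c > 0" and no: "\<not> (\<exists>k\<ge>K. a k < c)"
    have "ereal c \<le> liminf (\<lambda>k. ereal (a k))"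
      using no by (intro Liminf_bounded) (auto simp: eventually_sequentially not_less)
    then show False using lim \<open>c > 0\<close> by simp
  qed
next
  assume freq: "\<forall>c>0. \<forall>K. \<exists>k\<ge>K. a k < c"
  have "0 \<le> liminf (\<lambda>k. ereal (a k))"
    using assms by (intro Liminf_bounded) auto
  moreover have "\<not> 0 < liminf (\<lambda>k. ereal (a k))"
  proof
    assume "0 < liminf (\<lambda>k. ereal (a k))"
    then obtain c where c: "0 < ereal c" "ereal c < liminf (\<lambda>k. ereal (a k))"
      using ereal_dense2 by blast
    then obtain K where "\<forall>k\<ge>K. c < a k"
      using less_LiminfD[OF c(2)] by (auto simp: eventually_sequentially)
    moreover from c(1) freq obtain k where "k \<ge> K" "a k < c" by auto
    ultimately show False by force
  qed
  ultimately show "liminf (\<lambda>k. ereal (a k)) = 0" by simp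
qed

lemma card_filter_add_card_filter_not:
  "card {n\<in>{1..k::nat}. P n} + card {n\<in>{1..k}. \<not> P n} = k"
proof -
  have "card ({n\<in>{1..k}. P n} \<union> {n\<in>{1..k}. \<not> P n}) =
      card {n\<in>{1..k}. P n} + card {n\<in>{1..k}. \<not> P n}"
    by (rule card_Un_disjoint) auto
  moreover have "{n\<in>{1..k}. P n} \<union> {n\<in>{1..k}. \<not> P n} = {1..k}" by auto
  ultimately show ?thesis by simp
qed

lemma card_filter_le: "card {n\<in>{1..k::nat}. P n} \<le> k"
  using card_filter_add_card_filter_not[of k P] by linarith

text \<open>At \<open>k = 0\<close> the quotient is \<open>0\<close> by the convention on division
  and would meet every positive bound. Demanding \<open>k \<ge> 1\<close> excludes this and lets the
  quotient be multiplied out.\<close>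

lemma liminf_density_eq_0_iff:
  "liminf (\<lambda>k. ereal (real (card {n\<in>{1..k}. P n}) / real k)) = 0 \<longleftrightarrow>
    (\<forall>c>0. \<forall>K. \<exists>k\<ge>K. k \<ge> 1 \<and> real (card {n\<in>{1..k}. P n}) < c * real k)"
proof (subst liminf_ereal_eq_0_iff; (safe)?)
  fix c :: real and K :: nat
  assume "\<forall>c>0. \<forall>K. \<exists>k\<ge>K. real (card {n\<in>{1..k}. P n}) / real k < c" "c > 0"
  then obtain k where "k \<ge> Suc K" "real (card {n\<in>{1..k}. P n}) / real k < c" by blast
  then show "\<exists>k\<ge>K. k \<ge> 1 \<and> real (card {n\<in>{1..k}. P n}) < c * real k"
    by (intro exI[of _ k]) (auto simp: field_simps)
next
  fix c :: real and K :: nat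
  assume "\<forall>c>0. \<forall>K. \<exists>k\<ge>K. k \<ge> 1 \<and> real (card {n\<in>{1..k}. P n}) < c * real k" "c > 0"
  then obtain k where "k \<ge> K" "k \<ge> 1" "real (card {n\<in>{1..k}. P n}) < c * real k" by blast
  then show "\<exists>k\<ge>K. real (card {n\<in>{1..k}. P n}) / real k < c"
    by (intro exI[of _ k]) (auto simp: field_simps)
qed auto

text \<open>The complement is counted so that both density conditions become the same kind of claim:
  exceptional times form an arbitrarily small share of some late \<open>{1..k}\<close>.\<close>

lemma limsup_density_eq_1_iff:
  "limsup (\<lambda>k. ereal (real (card {n\<in>{1..k}. P n}) / real k)) = 1 \<longleftrightarrow>
    (\<forall>c>0. \<forall>K. \<exists>k\<ge>K. k \<ge> 1 \<and> real (card {n\<in>{1..k}. \<not> P n}) < c * real k)"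
proof -
  have le1: "real (card {n\<in>{1..k}. P n}) / real k \<le> 1" for k
    using card_filter_le[of k P] by (cases "k = 0") auto
  have eq: "1 - c < real (card {n\<in>{1..k}. P n}) / real k \<longleftrightarrow>
      real (card {n\<in>{1..k}. \<not> P n}) < c * real k" if "k \<ge> 1" for c k
  proof -
    have "real (card {n\<in>{1..k}. P n}) = real k - real (card {n\<in>{1..k}. \<not> P n})"
      using card_filter_add_card_filter_not[of k P] by linarith
    then show ?thesis using that by (auto simp: field_simps)
  qed
  show ?thesis
  proof (subst limsup_ereal_eq_1_iff[OF le1]; safe)
    fix c :: real and K :: nat
    assume *: "\<forall>c<1. \<forall>K. \<exists>k\<ge>K. c < real (card {n\<in>{1..k}. P n}) / real k" and "c > 0"
    then have "1 - c < 1" by simp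
    with * obtain k where "k \<ge> Suc K" "1 - c < real (card {n\<in>{1..k}. P n}) / real k" by blast
    then show "\<exists>k\<ge>K. k \<ge> 1 \<and> real (card {n\<in>{1..k}. \<not> P n}) < c * real k"
      using eq[of k c] by (intro exI[of _ k]) auto
  next
    fix c :: real and K :: nat
    assume *: "\<forall>c>0. \<forall>K. \<exists>k\<ge>K. k \<ge> 1 \<and> real (card {n\<in>{1..k}. \<not> P n}) < c * real k"
      and "c < 1"
    then have "1 - c > 0" by simp
    with * obtain k where "k \<ge> K" "k \<ge> 1" "real (card {n\<in>{1..k}. \<not> P n}) < (1 - c) * real k"
      by blast
    then show "\<exists>k\<ge>K. c < real (card {n\<in>{1..k}. P n}) / real k"
      using eq[of k "1 - c"] by (intro exI[of _ k]) auto
  qed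
qed

subsection \<open>Frechet spaces\<close>

locale frechet =
  fixes smul :: "'a::{real_normed_field,banach} \<Rightarrow> 'b::ab_group_add \<Rightarrow> 'b"
    and X :: "'b set" and p :: "nat \<Rightarrow> 'b \<Rightarrow> real"
  assumes frechet: "frechet_space smul X p"
begin

abbreviation d where "d \<equiv> frechet_dist X p"

sublocale vector_space smul
  using frechet by (simp add: frechet_space_def)

sublocale M: Metric_space X d
  using frechet by (simp add: frechet_space_def)

lemma subspace_X: "subspace X"
  using frechet by (simp add: frechet_space_def)

lemma zero_in [simp]: "0 \<in> X"
  and add_in [simp]: "x \<in> X \<Longrightarrow> y \<in> X \<Longrightarrow> x + y \<in> X"
  and diff_in [simp]: "x \<in> X \<Longrightarrow> y \<in> X \<Longrightarrow> x - y \<in> X"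
  and scale_in [simp]: "x \<in> X \<Longrightarrow> smul c x \<in> X"
  and sum_in: "(\<And>i. i \<in> I \<Longrightarrow> f i \<in> X) \<Longrightarrow> sum f I \<in> X"
  using subspace_X subspace_0 subspace_add subspace_diff subspace_scale subspace_sum by metis+

lemma seminorm_nonneg: "k \<ge> 1 \<Longrightarrow> x \<in> X \<Longrightarrow> 0 \<le> p k x"
  and seminorm_triangle: "k \<ge> 1 \<Longrightarrow> x \<in> X \<Longrightarrow> y \<in> X \<Longrightarrow> p k (x + y) \<le> p k x + p k y"
  and seminorm_scale: "k \<ge> 1 \<Longrightarrow> x \<in> X \<Longrightarrow> p k (smul c x) = norm c * p k x"
  using frechet by (auto simp: frechet_space_def seminorm_on_def)

lemma seminorm_mono:
  assumes "1 \<le> k" "k \<le> l" "x \<in> X"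
  shows "p k x \<le> p l x"
  using assms(2)
proof (induction rule: dec_induct)
  case (step n)
  then have "p n x \<le> p (Suc n) x"
    using frechet assms by (auto simp: frechet_space_def)
  with step show ?case by simp
qed simp

lemma seminorm_zero [simp]: "k \<ge> 1 \<Longrightarrow> p k 0 = 0"
  using seminorm_scale[of k 0 0] by simp

lemma seminorm_minus: "k \<ge> 1 \<Longrightarrow> x \<in> X \<Longrightarrow> p k (- x) = p k x"
  using seminorm_scale[of k x "-1"] by simp

lemma seminorm_diff_triangle:
  assumes "k \<ge> 1" "x \<in> X" "y \<in> X"
  shows "p k x \<le> p k (x - y) + p k y"
  using seminorm_triangle[of k "x - y" y] assms by simp

lemma seminorm_minus_commute:
  assumes "k \<ge> 1" "x \<in> X" "y \<in> X"
  shows "p k (x - y) = p k (y - x)"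
  using seminorm_minus[of k "x - y"] assms by simp

lemma seminorm_add_lower:
  assumes "k \<ge> 1" "x \<in> X" "y \<in> X"
  shows "p k x - p k y \<le> p k (x + y)"
  using seminorm_diff_triangle[of k x "-y"] seminorm_minus[of k y] assms
    diff_in[of 0 y] by simp

section \<open>Comparison of the metric with single seminorms\<close>

lemma dist_summable:
  assumes "v \<in> X"
  shows "summable (\<lambda>k. (1/2) ^ Suc k * min 1 (p (Suc k) v))"
proof (rule summable_comparison_test'[where N = 0])
  show "summable (\<lambda>k. (1/2::real) ^ Suc k)" using power_half_series by (rule sums_summable)
  fix k :: nat
  have nn: "0 \<le> p (Suc k) v" using seminorm_nonneg assms by simp
  then have "(1/2) ^ Suc k * min 1 (p (Suc k) v) \<le> (1/2) ^ Suc k"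
    by (intro mult_left_le) auto
  moreover have "0 \<le> (1/2) ^ Suc k * min 1 (p (Suc k) v)" using nn by simp
  ultimately show "norm ((1/2) ^ Suc k * min 1 (p (Suc k) v)) \<le> (1/2::real) ^ Suc k"
    unfolding real_norm_def by linarith
qed

text \<open>The series is cut after \<open>k\<close> terms. By monotonicity of the seminorms the
  head is at most \<open>p k (x - y)\<close> times a partial geometric sum bounded by 1, and the
  tail is at most \<open>(1/2) ^ k\<close>.\<close>

lemma dist_le:
  assumes "k \<ge> 1" "x \<in> X" "y \<in> X"
  shows "d x y \<le> p k (x - y) + (1/2) ^ k"
proof -
  define v where "v = x - y"
  have v: "v \<in> X" using assms by (simp add: v_def)
  define f where "f = (\<lambda>k. (1/2) ^ Suc k * min 1 (p (Suc k) v))"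
  have sf: "summable f" unfolding f_def by (rule dist_summable[OF v])
  have tail: "(\<lambda>n. (1/2::real) ^ Suc (n + k)) sums ((1/2) ^ k)"
    using sums_mult[OF power_half_series, of "(1/2)^k"] by (simp add: power_add mult_ac)
  have "(\<Sum>n. f (n + k)) \<le> (1/2) ^ k"
    unfolding sums_unique[OF tail]
  proof (rule suminf_le)
    show "f (n + k) \<le> (1/2) ^ Suc (n + k)" for n
      unfolding f_def by (rule mult_left_le) auto
    show "summable (\<lambda>n. f (n + k))" using sf by (rule summable_ignore_initial_segment)
    show "summable (\<lambda>n. (1/2::real) ^ Suc (n + k))" using tail by (rule sums_summable)
  qed
  moreover have "(\<Sum>n<k. f n) \<le> p k v"
  proof -
    have "(\<Sum>n<k. f n) \<le> (\<Sum>n<k. (1/2) ^ Suc n * p k v)"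
    proof (rule sum_mono)
      fix n assume "n \<in> {..<k}"
      then have "p (Suc n) v \<le> p k v" using v by (intro seminorm_mono) auto
      then show "f n \<le> (1/2) ^ Suc n * p k v" unfolding f_def by (intro mult_left_mono) auto
    qed
    also have "\<dots> = (\<Sum>n<k. (1/2) ^ Suc n) * p k v" by (simp add: sum_distrib_right)
    also have "\<dots> \<le> 1 * p k v"
    proof (rule mult_right_mono)
      show "(\<Sum>n<k. (1/2::real) ^ Suc n) \<le> 1"
        using sum_le_suminf[OF sums_summable[OF power_half_series], of "{..<k}"]
          sums_unique[OF power_half_series] by simp
    qed (use assms v seminorm_nonneg in auto)
    finally show ?thesis by simp
  qed
  moreover have "d x y = suminf f" using assms by (simp add: frechet_dist_def f_def v_def)
  ultimately show ?thesis using suminf_split_initial_segment[OF sf, of k] by (simp add: v_def)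
qed

text \<open>All terms of the series are nonnegative, so the one belonging to \<open>p k\<close>
  bounds the sum from below.\<close>

lemma le_dist:
  assumes "k \<ge> 1" "x \<in> X" "y \<in> X"
  shows "(1/2) ^ k * min 1 (p k (x - y)) \<le> d x y"
proof -
  obtain j where j: "k = Suc j" using assms(1) by (cases k) auto
  define f where "f = (\<lambda>k. (1/2) ^ Suc k * min 1 (p (Suc k) (x - y)))"
  have "sum f {j} \<le> suminf f"
  proof (rule sum_le_suminf)
    show "summable f" unfolding f_def by (rule dist_summable) (use assms in simp)
    show "0 \<le> f n" for n using seminorm_nonneg[of "Suc n" "x - y"] assms by (simp add: f_def)
  qed simp
  then show ?thesis using assms unfolding j by (simp only: frechet_dist_def f_def) simp
qed

text \<open>A truncated value \<open>min 1 (p k (x - y))\<close> below \<open>\<eta> \<le> 1\<close>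
  is the seminorm itself.\<close>

lemma seminorm_less_if_dist_less:
  assumes "k \<ge> 1" "x \<in> X" "y \<in> X" "d x y < (1/2) ^ k * \<eta>" "\<eta> \<le> 1"
  shows "p k (x - y) < \<eta>"
proof -
  have "(1/2) ^ k * min 1 (p k (x - y)) < (1/2) ^ k * \<eta>"
    using le_dist[OF assms(1-3)] assms(4) by linarith
  then show ?thesis using assms(5) by (auto simp: min_def split: if_splits)
qed

text \<open>Half of \<open>\<tau>\<close> is spent on the tail \<open>(1/2) ^ k\<close>, the other
  half on the seminorm. With the preceding estimate this replaces the metric by single seminorms
  throughout.\<close>

lemma dist_less_if_seminorm_less:
  assumes "\<tau> > 0"
  obtains k where "k \<ge> 1"
    "\<And>x y. x \<in> X \<Longrightarrow> y \<in> X \<Longrightarrow> p k (x - y) < \<tau> / 2 \<Longrightarrow> d x y < \<tau>"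
proof -
  obtain k where k: "(1/2::real) ^ k < \<tau> / 2"
    using real_arch_pow_inv[of "\<tau> / 2" "1/2"] assms by auto
  have "(1/2::real) ^ Suc k \<le> (1/2) ^ k" by simp
  with k have "(1/2::real) ^ Suc k < \<tau> / 2" by linarith
  then show ?thesis
    using dist_le[of "Suc k"] that[of "Suc k"] by fastforce
qed

section \<open>Convergence and completeness through seminorms\<close>

lemma limitin_iff:
  assumes "\<And>n. \<sigma> n \<in> X" "x \<in> X"
  shows "limitin (frechet_topology X p) \<sigma> x sequentially \<longleftrightarrow>
    (\<forall>k\<ge>1. (\<lambda>n. p k (\<sigma> n - x)) \<longlonglongrightarrow> 0)"
proof -
  have "(\<forall>k\<ge>1. (\<lambda>n. p k (\<sigma> n - x)) \<longlonglongrightarrow> 0) \<longleftrightarrow>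
      (\<forall>k\<ge>1. \<forall>\<eta>>0. \<exists>N. \<forall>n\<ge>N. p k (\<sigma> n - x) < \<eta>)"
    using seminorm_nonneg assms by (auto simp: LIMSEQ_iff)
  also have "\<dots> \<longleftrightarrow> (\<forall>\<tau>>0. \<exists>N. \<forall>n\<ge>N. d (\<sigma> n) x < \<tau>)"
  proof safe
    fix \<tau> :: real assume *: "\<forall>k\<ge>1. \<forall>\<eta>>0. \<exists>N. \<forall>n\<ge>N. p k (\<sigma> n - x) < \<eta>" and "\<tau> > 0"
    obtain k where "k \<ge> 1" "\<And>x y. x \<in> X \<Longrightarrow> y \<in> X \<Longrightarrow> p k (x - y) < \<tau> / 2 \<Longrightarrow> d x y < \<tau>"
      using dist_less_if_seminorm_less[OF \<open>\<tau> > 0\<close>] by blast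
    then show "\<exists>N. \<forall>n\<ge>N. d (\<sigma> n) x < \<tau>"
      using * \<open>\<tau> > 0\<close> assms by (meson half_gt_zero)
  next
    fix k :: nat and \<eta> :: real
    assume *: "\<forall>\<tau>>0. \<exists>N. \<forall>n\<ge>N. d (\<sigma> n) x < \<tau>" and "k \<ge> 1" "\<eta> > 0"
    then have "(1/2) ^ k * min \<eta> 1 > 0" by simp
    with * obtain N where "\<forall>n\<ge>N. d (\<sigma> n) x < (1/2) ^ k * min \<eta> 1" by blast
    then have "\<forall>n\<ge>N. p k (\<sigma> n - x) < min \<eta> 1"
      using seminorm_less_if_dist_less[of k _ x "min \<eta> 1"] \<open>k \<ge> 1\<close> assms by auto
    then show "\<exists>N. \<forall>n\<ge>N. p k (\<sigma> n - x) < \<eta>" by auto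
  qed
  finally show ?thesis
    using assms by (simp add: frechet_topology_def M.limit_metric_sequentially)
qed

text \<open>Completeness in the form needed to sum a series whose tails are controlled one seminorm
  at a time. By symmetry of \<open>d\<close>, pairs with \<open>n' \<ge> n\<close> suffice.\<close>

lemma seminorm_Cauchy_convergent:
  assumes "\<And>n. \<sigma> n \<in> X"
    and cauchy: "\<And>k \<eta>. k \<ge> 1 \<Longrightarrow> \<eta> > 0 \<Longrightarrow> \<exists>N. \<forall>n\<ge>N. \<forall>n'\<ge>n. p k (\<sigma> n' - \<sigma> n) < \<eta>"
  obtains x where "x \<in> X" "\<And>k. k \<ge> 1 \<Longrightarrow> (\<lambda>n. p k (\<sigma> n - x)) \<longlonglongrightarrow> 0"
proof -
  have "M.MCauchy \<sigma>"
    unfolding M.MCauchy_def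
  proof (intro conjI allI impI)
    fix \<tau> :: real assume "\<tau> > 0"
    obtain k where k: "k \<ge> 1" "\<And>x y. x \<in> X \<Longrightarrow> y \<in> X \<Longrightarrow> p k (x - y) < \<tau> / 2 \<Longrightarrow> d x y < \<tau>"
      using dist_less_if_seminorm_less[OF \<open>\<tau> > 0\<close>] by blast
    obtain N where N: "\<forall>n\<ge>N. \<forall>n'\<ge>n. p k (\<sigma> n' - \<sigma> n) < \<tau> / 2"
      using cauchy[of k "\<tau> / 2"] k \<open>\<tau> > 0\<close> by auto
    have "d (\<sigma> n) (\<sigma> n') < \<tau>" if "n \<ge> N" "n' \<ge> N" for n n'
      using N that k assms(1) M.commute by (metis nle_le)
    then show "\<exists>N. \<forall>n n'. N \<le> n \<longrightarrow> N \<le> n' \<longrightarrow> d (\<sigma> n) (\<sigma> n') < \<tau>" by blast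
  qed (use assms in auto)
  moreover have "M.mcomplete" using frechet by (simp add: frechet_space_def)
  ultimately obtain x where x: "limitin M.mtopology \<sigma> x sequentially"
    unfolding M.mcomplete_def by blast
  then have "x \<in> X" using M.limit_metric_sequentially by blast
  moreover from this x have "\<forall>k\<ge>1. (\<lambda>n. p k (\<sigma> n - x)) \<longlonglongrightarrow> 0"
    using limitin_iff[of \<sigma> x] assms(1) by (simp add: frechet_topology_def)
  ultimately show ?thesis using that by blast
qed

text \<open>This is the reverse triangle inequality, used to pass to the limit inside a
  seminorm.\<close>

lemma seminorm_tendsto:
  assumes "k \<ge> 1" "\<And>n. \<sigma> n \<in> X" "x \<in> X" "(\<lambda>n. p k (\<sigma> n - x)) \<longlonglongrightarrow> 0"
  shows "(\<lambda>n. p k (\<sigma> n)) \<longlonglongrightarrow> p k x"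
proof (rule LIM_zero_cancel, rule Lim_null_comparison)
  show "\<forall>\<^sub>F n in sequentially. norm (p k (\<sigma> n) - p k x) \<le> p k (\<sigma> n - x)"
  proof (rule always_eventually, rule allI)
    fix n
    have "p k (\<sigma> n) \<le> p k (\<sigma> n - x) + p k x" "p k x \<le> p k (x - \<sigma> n) + p k (\<sigma> n)"
      using assms seminorm_diff_triangle by auto
    then show "norm (p k (\<sigma> n) - p k x) \<le> p k (\<sigma> n - x)"
      using seminorm_minus_commute[of k "\<sigma> n" x] assms by simp
  qed
qed (use assms(4) in auto)

end

subsection \<open>Continuous linear operators\<close>

locale frechet_operator = frechet +
  fixes T :: "'b \<Rightarrow> 'b"
  assumes T_in: "x \<in> X \<Longrightarrow> T x \<in> X"
    and T_add: "x \<in> X \<Longrightarrow> y \<in> X \<Longrightarrow> T (x + y) = T x + T y"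
    and T_scale: "x \<in> X \<Longrightarrow> T (smul c x) = smul c (T x)"
    and T_continuous: "continuous_map (frechet_topology X p) (frechet_topology X p) T"
begin

lemma pow_in [simp]: "x \<in> X \<Longrightarrow> (T ^^ n) x \<in> X"
  by (induction n) (auto simp: T_in)

lemma pow_add: "x \<in> X \<Longrightarrow> y \<in> X \<Longrightarrow> (T ^^ n) (x + y) = (T ^^ n) x + (T ^^ n) y"
  by (induction n) (auto simp: T_add)

lemma pow_scale: "x \<in> X \<Longrightarrow> (T ^^ n) (smul c x) = smul c ((T ^^ n) x)"
  by (induction n) (auto simp: T_scale)

lemma pow_diff:
  assumes "x \<in> X" "y \<in> X"
  shows "(T ^^ n) (x - y) = (T ^^ n) x - (T ^^ n) y"
  using pow_add[of "x - y" y n] assms by (simp add: eq_diff_eq)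

lemma pow_zero [simp]: "(T ^^ n) 0 = 0"
  using pow_diff[of 0 0 n] by simp

lemma pow_sum:
  assumes "\<And>i. i \<in> I \<Longrightarrow> f i \<in> X"
  shows "(T ^^ n) (sum f I) = (\<Sum>i\<in>I. (T ^^ n) (f i))"
  using assms
  by (induction I rule: infinite_finite_induct) (auto simp: pow_add sum_in)

section \<open>Seminorm bounds for a continuous operator and its powers\<close>

text \<open>Continuity at \<open>0\<close> yields a \<open>p q\<close>-ball on which
  \<open>p i (T v)\<close> stays below 1. Scaling an arbitrary vector into that ball turns this into
  a linear bound.\<close>

lemma T_bounded:
  assumes "i \<ge> 1"
  obtains q C where "q \<ge> 1" "C \<ge> 0" "\<And>v. v \<in> X \<Longrightarrow> p i (T v) \<le> C * p q v"
proof -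
  have T0: "T 0 = 0" using pow_zero[of 1] by simp
  have "\<forall>a\<in>X. \<forall>\<epsilon>>0. \<exists>\<delta>>0. \<forall>x. x \<in> X \<and> d a x < \<delta> \<longrightarrow> d (T a) (T x) < \<epsilon>"
    using T_continuous M.metric_continuous_map[OF M.Metric_space_axioms]
    by (simp add: frechet_topology_def)
  then have "\<exists>\<delta>>0. \<forall>x. x \<in> X \<and> d 0 x < \<delta> \<longrightarrow> d (T 0) (T x) < (1/2) ^ i"
    by (elim ballE[of _ _ 0] allE[of _ "(1/2) ^ i"]) auto
  then obtain \<delta> where \<delta>: "\<delta> > 0" "\<And>x. x \<in> X \<Longrightarrow> d x 0 < \<delta> \<Longrightarrow> d (T x) 0 < (1/2) ^ i"
    using M.commute T0 by metis
  obtain q where q: "q \<ge> 1" "\<And>x y. x \<in> X \<Longrightarrow> y \<in> X \<Longrightarrow> p q (x - y) < \<delta> / 2 \<Longrightarrow> d x y < \<delta>"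
    using dist_less_if_seminorm_less[OF \<delta>(1)] by blast
  have small: "p i (T v) < 1" if "v \<in> X" "p q v < \<delta> / 2" for v
    using seminorm_less_if_dist_less[of i "T v" 0 1] \<delta>(2)[of v] q(2)[of v 0] that assms T_in by simp
  have "p i (T v) \<le> 4 / \<delta> * p q v" if v: "v \<in> X" for v
  proof (rule field_le_epsilon)
    fix e :: real assume "e > 0"
    \<comment> \<open>The summand with \<open>e\<close> keeps the denominator positive even if
      \<open>p q v = 0\<close>. The scaled vector has \<open>t * p q v \<le> \<delta> / 4\<close>,
      and \<open>1 / t\<close> is exactly the bound wanted up to the error \<open>e\<close>.\<close>
    define t where "t = \<delta> / 4 / (p q v + e * \<delta> / 4)"
    have nn: "p q v \<ge> 0" using seminorm_nonneg q v by simp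
    then have pos: "p q v + e * \<delta> / 4 > 0" using \<open>e > 0\<close> \<delta>(1) by (simp add: add_nonneg_pos)
    then have t: "t > 0" using \<delta>(1) by (simp add: t_def)
    have "t * p q v < \<delta> / 2"
    proof -
      have "t * p q v \<le> t * (p q v + e * \<delta> / 4)"
        using t \<open>e > 0\<close> \<delta>(1) by (intro mult_left_mono) auto
      also have "\<dots> = \<delta> / 4" unfolding t_def using pos by (intro nonzero_eq_divide_eq[THEN iffD1]) auto
      finally show ?thesis using \<delta>(1) by simp
    qed
    then have "p i (T (smul (of_real t) v)) < 1"
      using t v q(1) by (intro small) (auto simp: seminorm_scale)
    then have "t * p i (T v) < 1" using t v assms by (simp add: T_scale T_in seminorm_scale)
    then have "p i (T v) < 1 / t" using t by (simp add: field_simps)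
    also have "1 / t = 4 / \<delta> * p q v + e" using \<delta>(1) pos by (simp add: t_def field_simps)
    finally show "p i (T v) \<le> 4 / \<delta> * p q v + e" by simp
  qed
  then show ?thesis using that[of q "4 / \<delta>"] q(1) \<delta>(1) by auto
qed

text \<open>A single pair \<open>q\<close>, \<open>C\<close> serves all times up to
  \<open>L\<close>, so one rescaling makes a whole initial stretch of an orbit small. The induction
  splits off one application of \<open>T\<close> and bounds it by \<open>T_bounded\<close> at the
  seminorm \<open>p q\<close>.\<close>

lemma pow_bounded:
  assumes "i \<ge> 1"
  shows "\<exists>q\<ge>1. \<exists>C\<ge>1. \<forall>n\<le>L. \<forall>v\<in>X. p i ((T ^^ n) v) \<le> C * p q v"
proof (induction L)
  case 0
  show ?case using assms by (intro exI[of _ i] conjI exI[of _ 1]) auto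
next
  case (Suc L)
  then obtain q C where q: "q \<ge> 1" "C \<ge> 1"
    and C: "\<And>n v. n \<le> L \<Longrightarrow> v \<in> X \<Longrightarrow> p i ((T ^^ n) v) \<le> C * p q v" by blast
  obtain q' C' where q': "q' \<ge> 1" "C' \<ge> 0" and C': "\<And>v. v \<in> X \<Longrightarrow> p q (T v) \<le> C' * p q' v"
    using T_bounded[OF q(1)] by blast
  show ?case
  proof (intro exI[of _ "max q q'"] conjI exI[of _ "max C (C * C')"] allI impI ballI)
    fix n v assume n: "n \<le> Suc L" and v: "v \<in> X"
    have mono: "p q v \<le> p (max q q') v" "p q' v \<le> p (max q q') v" "0 \<le> p (max q q') v"
      using v q q' by (auto intro!: seminorm_mono seminorm_nonneg)
    show "p i ((T ^^ n) v) \<le> max C (C * C') * p (max q q') v"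
    proof (cases "n \<le> L")
      case True
      then have "p i ((T ^^ n) v) \<le> C * p q v" using C v by simp
      also have "\<dots> \<le> max C (C * C') * p (max q q') v"
        using mono q seminorm_nonneg[of q v] v by (intro mult_mono) auto
      finally show ?thesis .
    next
      case False
      with n have "n = Suc L" by simp
      then have "(T ^^ n) v = (T ^^ L) (T v)" by (simp only: funpow_Suc_right o_apply)
      then have "p i ((T ^^ n) v) \<le> C * p q (T v)" using C[of L "T v"] v T_in by simp
      also have "\<dots> \<le> C * (C' * p q' v)" using C'[OF v] q by simp
      also have "\<dots> = (C * C') * p q' v" by simp
      also have "\<dots> \<le> max C (C * C') * p (max q q') v"
        using mono q q' seminorm_nonneg[of q' v] v by (intro mult_mono) auto
      finally show ?thesis .
    qed
  qed (use q q' in auto)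
qed

lemma pow_tendsto:
  assumes "i \<ge> 1" "\<And>n. \<sigma> n \<in> X" "x \<in> X" "\<And>k. k \<ge> 1 \<Longrightarrow> (\<lambda>n. p k (\<sigma> n - x)) \<longlonglongrightarrow> 0"
  shows "(\<lambda>n. p i ((T ^^ j) (\<sigma> n) - (T ^^ j) x)) \<longlonglongrightarrow> 0"
proof -
  obtain q C where q: "q \<ge> 1" and C: "\<And>v. v \<in> X \<Longrightarrow> p i ((T ^^ j) v) \<le> C * p q v"
    using pow_bounded[OF assms(1), of j] by blast
  show ?thesis
  proof (rule Lim_null_comparison)
    show "(\<lambda>n. C * p q (\<sigma> n - x)) \<longlonglongrightarrow> 0"
      using tendsto_mult_right_zero[OF assms(4)[OF q]] .
    show "\<forall>\<^sub>F n in sequentially. norm (p i ((T ^^ j) (\<sigma> n) - (T ^^ j) x)) \<le> C * p q (\<sigma> n - x)"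
      using C assms seminorm_nonneg by (simp flip: pow_diff)
  qed
qed

section \<open>Irregular vectors and scrambled lines\<close>

text \<open>This is a distributionally irregular vector whose unboundedness is witnessed by the
  single seminorm \<open>p m\<close>. Thresholds \<open>A\<close> and \<open>\<eta>\<close> take the
  place of two sets of times of upper density one along which the orbit diverges, respectively tends
  to zero.\<close>

definition distributionally_irregular :: "nat \<Rightarrow> 'b \<Rightarrow> bool" where
  "distributionally_irregular m x \<longleftrightarrow> m \<ge> 1 \<and> x \<in> X \<and>
    (\<forall>A. \<forall>c>0. \<forall>K. \<exists>k\<ge>K. k \<ge> 1 \<and>
      real (card {n\<in>{1..k}. p m ((T ^^ n) x) \<le> A}) < c * real k) \<and>
    (\<forall>l\<ge>1. \<forall>\<eta>>0. \<forall>c>0. \<forall>K. \<exists>k\<ge>K. k \<ge> 1 \<and>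
      real (card {n\<in>{1..k}. \<eta> \<le> p l ((T ^^ n) x)}) < c * real k)"

text \<open>Differences of points on the real line through \<open>x\<close> are real multiples of
  \<open>x\<close>. As all thresholds are allowed, nonzero multiples inherit both clauses.\<close>

lemma distributionally_irregular_imp_chaotic:
  assumes "distributionally_irregular m x"
  shows "distributionally_chaotic X d T"
proof -
  have m: "m \<ge> 1" and x: "x \<in> X"
    and large: "\<And>A c K. c > 0 \<Longrightarrow> \<exists>k\<ge>K. k \<ge> 1 \<and>
      real (card {n\<in>{1..k}. p m ((T ^^ n) x) \<le> A}) < c * real k"
    and small: "\<And>l \<eta> c K. l \<ge> 1 \<Longrightarrow> \<eta> > 0 \<Longrightarrow> c > 0 \<Longrightarrow> \<exists>k\<ge>K. k \<ge> 1 \<and>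
      real (card {n\<in>{1..k}. \<eta> \<le> p l ((T ^^ n) x)}) < c * real k"
    using assms by (auto simp: distributionally_irregular_def)
  \<comment> \<open>For \<open>x = 0\<close> every time would be counted at threshold
    \<open>A = 0\<close>, giving \<open>k < k\<close>. Being nonzero makes the line
    uncountable.\<close>
  have "x \<noteq> 0"
  proof
    assume "x = 0"
    then have "{n\<in>{1..k}. p m ((T ^^ n) x) \<le> 0} = {1..k}" for k using m by auto
    then show False using large[of 1 0 0] by auto
  qed
  define g where "g = (\<lambda>t::real. smul (of_real t) x)"
  have "inj g"
    using \<open>x \<noteq> 0\<close> by (intro injI) (simp add: g_def)
  then have unc: "uncountable (range g)"
    using uncountable_UNIV_real countable_image_inj_on by blast
  have seminorm_g: "p l ((T ^^ n) (g s) - (T ^^ n) (g t)) = \<bar>s - t\<bar> * p l ((T ^^ n) x)"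
    if "l \<ge> 1" for l n s t
  proof -
    have "(T ^^ n) (g s) - (T ^^ n) (g t) = smul (of_real (s - t)) ((T ^^ n) x)"
      using x by (simp add: g_def pow_scale scale_left_diff_distrib)
    then show ?thesis using seminorm_scale[OF that, of "(T ^^ n) x" "of_real (s - t)"] x
      by (metis norm_of_real pow_in)
  qed
  have g_in: "g t \<in> X" for t using x by (simp add: g_def)
  \<comment> \<open>The constant \<open>(1/2) ^ m\<close> works for all pairs: a smaller distance
    forces \<open>p m\<close> of the difference below 1, so \<open>p m ((T ^^ n) x)\<close> is at
    most \<open>1 / \<bar>s - t\<bar>\<close>, a fixed threshold for the pair.\<close>
  have liminf_g: "liminf (\<lambda>k. ereal (real (card {n\<in>{1..k}. d ((T ^^ n) (g s)) ((T ^^ n) (g t)) < (1/2) ^ m}) / real k)) = 0"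
    if "s \<noteq> t" for s t
    unfolding liminf_density_eq_0_iff
  proof (intro allI impI)
    fix c :: real and K :: nat assume "c > 0"
    then obtain k where k: "k \<ge> K" "k \<ge> 1"
      "real (card {n\<in>{1..k}. p m ((T ^^ n) x) \<le> 1 / \<bar>s - t\<bar>}) < c * real k"
      using large by blast
    have "card {n\<in>{1..k}. d ((T ^^ n) (g s)) ((T ^^ n) (g t)) < (1/2) ^ m}
        \<le> card {n\<in>{1..k}. p m ((T ^^ n) x) \<le> 1 / \<bar>s - t\<bar>}"
    proof (rule card_mono)
      show "{n\<in>{1..k}. d ((T ^^ n) (g s)) ((T ^^ n) (g t)) < (1/2) ^ m}
        \<subseteq> {n\<in>{1..k}. p m ((T ^^ n) x) \<le> 1 / \<bar>s - t\<bar>}"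
      proof safe
        fix n assume "d ((T ^^ n) (g s)) ((T ^^ n) (g t)) < (1/2) ^ m"
        then have "p m ((T ^^ n) (g s) - (T ^^ n) (g t)) < 1"
          using seminorm_less_if_dist_less[of m "(T ^^ n) (g s)" "(T ^^ n) (g t)" 1] m g_in by simp
        then show "p m ((T ^^ n) x) \<le> 1 / \<bar>s - t\<bar>"
          using that unfolding seminorm_g[OF m] by (simp add: field_simps)
      qed
    qed simp
    then show "\<exists>k\<ge>K. k \<ge> 1 \<and>
        real (card {n\<in>{1..k}. d ((T ^^ n) (g s)) ((T ^^ n) (g t)) < (1/2) ^ m}) < c * real k"
      using k by (intro exI[of _ k]) auto
  qed
  have limsup_g: "limsup (\<lambda>k. ereal (real (card {n\<in>{1..k}. d ((T ^^ n) (g s)) ((T ^^ n) (g t)) < \<tau>}) / real k)) = 1"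
    if "s \<noteq> t" "\<tau> > 0" for s t \<tau>
    unfolding limsup_density_eq_1_iff
  proof (intro allI impI)
    fix c :: real and K :: nat assume "c > 0"
    obtain l where l: "l \<ge> 1"
      "\<And>x y. x \<in> X \<Longrightarrow> y \<in> X \<Longrightarrow> p l (x - y) < \<tau> / 2 \<Longrightarrow> d x y < \<tau>"
      using dist_less_if_seminorm_less[OF \<open>\<tau> > 0\<close>] by blast
    have pos: "\<tau> / 2 / \<bar>s - t\<bar> > 0" using that by simp
    obtain k where k: "k \<ge> K" "k \<ge> 1"
      "real (card {n\<in>{1..k}. \<tau> / 2 / \<bar>s - t\<bar> \<le> p l ((T ^^ n) x)}) < c * real k"
      using small[OF l(1) pos \<open>c > 0\<close>] by blast
    have "card {n\<in>{1..k}. \<not> d ((T ^^ n) (g s)) ((T ^^ n) (g t)) < \<tau>}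
        \<le> card {n\<in>{1..k}. \<tau> / 2 / \<bar>s - t\<bar> \<le> p l ((T ^^ n) x)}"
    proof (rule card_mono)
      show "{n\<in>{1..k}. \<not> d ((T ^^ n) (g s)) ((T ^^ n) (g t)) < \<tau>}
        \<subseteq> {n\<in>{1..k}. \<tau> / 2 / \<bar>s - t\<bar> \<le> p l ((T ^^ n) x)}"
      proof safe
        fix n assume "\<not> d ((T ^^ n) (g s)) ((T ^^ n) (g t)) < \<tau>"
        then have "\<not> p l ((T ^^ n) (g s) - (T ^^ n) (g t)) < \<tau> / 2"
          using l g_in by auto
        then show "\<tau> / 2 / \<bar>s - t\<bar> \<le> p l ((T ^^ n) x)"
          using that unfolding seminorm_g[OF l(1)] by (simp add: field_simps)
      qed
    qed simp
    then show "\<exists>k\<ge>K. k \<ge> 1 \<and>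
        real (card {n\<in>{1..k}. \<not> d ((T ^^ n) (g s)) ((T ^^ n) (g t)) < \<tau>}) < c * real k"
      using k by (intro exI[of _ k]) auto
  qed
  show ?thesis
    unfolding distributionally_chaotic_def
  proof (intro exI[of _ "range g"] exI[of _ "(1/2) ^ m"] conjI ballI impI allI)
    fix a b assume "a \<in> range g" "b \<in> range g" "a \<noteq> b"
    then obtain s t where st: "a = g s" "b = g t" "s \<noteq> t" by blast
    show "liminf (\<lambda>k. ereal (real (card {n\<in>{1..k}. d ((T ^^ n) a) ((T ^^ n) b) < (1/2) ^ m}) / real k)) = 0"
      unfolding st by (rule liminf_g[OF st(3)])
    show "limsup (\<lambda>k. ereal (real (card {n\<in>{1..k}. d ((T ^^ n) a) ((T ^^ n) b) < \<tau>}) / real k)) = 1"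
      if "\<tau> > 0" for \<tau>
      unfolding st by (rule limsup_g[OF st(3) that])
  qed (use unc g_in in auto)
qed

section \<open>Summing vectors whose orbits die\<close>

text \<open>The construction works for any continuous linear operator. Both \<open>k\<close> and
  \<open>N\<close> must be available beyond every \<open>K\<close>, because each new summand has to
  outgrow and outlast all earlier ones.\<close>

lemma escaping_vectors_imp_irregular:
  assumes m: "m \<ge> 1"
    and escape: "\<And>K. \<exists>k\<ge>K. \<exists>N\<ge>K. \<exists>y\<in>X. \<exists>S. (\<forall>n\<ge>S. (T ^^ n) y = 0) \<and> p k y \<noteq> 0 \<and>
      real (card {n\<in>{1..N}. p m ((T ^^ n) y) / p k y > real k}) > (1 - 1 / real k) * real N"
  shows "\<exists>x. distributionally_irregular m x"
proof -
  \<comment> \<open>A building block at level \<open>i\<close>: negligible up to time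
    \<open>L\<close>, larger than \<open>i\<close> at most times up to \<open>N\<close>, and dead
    from \<open>S\<close> on.\<close>
  have step: "\<exists>u\<in>X. \<exists>N\<ge>L. \<exists>S\<ge>N. N \<ge> 1 \<and> (\<forall>n\<ge>S. (T ^^ n) u = 0) \<and>
      (\<forall>n\<le>L. p i ((T ^^ n) u) \<le> (1/2) ^ i) \<and>
      real (card {n\<in>{1..N}. p m ((T ^^ n) u) \<le> real i}) \<le> real N / real i"
    if i: "i \<ge> 1" for i L
  proof -
    obtain q C where q: "q \<ge> 1" "C \<ge> 1"
      and C: "\<And>n v. n \<le> L \<Longrightarrow> v \<in> X \<Longrightarrow> p i ((T ^^ n) v) \<le> C * p q v"
      using pow_bounded[OF i, of L] by blast
    \<comment> \<open>The block \<open>u\<close> is normalised to \<open>p k u = c\<close>. Since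
      \<open>q \<le> k\<close>, its orbit up to \<open>L\<close> is then bounded by
      \<open>C * c = (1/2) ^ i\<close>.\<close>
    define c where "c = (1/2) ^ i / C"
    have c: "c > 0" using q by (simp add: c_def)
    \<comment> \<open>This guarantees \<open>i \<le> c * k\<close>, so a growth ratio above
      \<open>k\<close> for \<open>y\<close> means a seminorm above \<open>i\<close> for the rescaled
      vector.\<close>
    obtain K0 :: nat where K0: "real i / c \<le> real K0" using real_arch_simple by blast
    obtain k N y S where k: "k \<ge> q + i + L + K0 + 1" "N \<ge> q + i + L + K0 + 1"
      and y: "y \<in> X" "\<And>n. n \<ge> S \<Longrightarrow> (T ^^ n) y = 0" "p k y \<noteq> 0"
      and card: "real (card {n\<in>{1..N}. p m ((T ^^ n) y) / p k y > real k}) > (1 - 1 / real k) * real N"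
      using escape[of "q + i + L + K0 + 1"] by blast
    have pk: "p k y > 0" using seminorm_nonneg[of k y] y k by simp
    define u where "u = smul (of_real (c / p k y)) y"
    have u: "u \<in> X" using y by (simp add: u_def)
    have pu: "p l ((T ^^ n) u) = c * (p l ((T ^^ n) y) / p k y)" if "l \<ge> 1" for l n
      using y c pk that by (simp add: u_def pow_scale seminorm_scale norm_divide)
    have ik: "real i \<le> c * real k"
    proof -
      have "real i / c \<le> real k" using K0 k by linarith
      then show ?thesis using c by (simp add: field_simps)
    qed
    have "real (card {n\<in>{1..N}. p m ((T ^^ n) u) \<le> real i}) \<le> real N / real i"
    proof -
      have "card {n\<in>{1..N}. p m ((T ^^ n) u) \<le> real i}
          \<le> card {n\<in>{1..N}. \<not> p m ((T ^^ n) y) / p k y > real k}"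
      proof (rule card_mono)
        have "p m ((T ^^ n) y) / p k y \<le> real k" if "p m ((T ^^ n) u) \<le> real i" for n
        proof -
          have "c * (p m ((T ^^ n) y) / p k y) \<le> c * real k" using that ik pu[OF m] by simp
          then show ?thesis using c by (simp only: mult_le_cancel_left_pos)
        qed
        then show "{n\<in>{1..N}. p m ((T ^^ n) u) \<le> real i}
          \<subseteq> {n\<in>{1..N}. \<not> p m ((T ^^ n) y) / p k y > real k}" by (auto simp: not_less)
      qed simp
      also have "real (card {n\<in>{1..N}. \<not> p m ((T ^^ n) y) / p k y > real k})
          \<le> real N - (1 - 1 / real k) * real N"
        using card card_filter_add_card_filter_not[of N "\<lambda>n. p m ((T ^^ n) y) / p k y > real k"]
        by linarith
      also have "\<dots> = real N / real k" by (simp add: algebra_simps)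
      also have "\<dots> \<le> real N / real i" using k i by (intro divide_left_mono) auto
      finally show ?thesis by simp
    qed
    moreover have "p i ((T ^^ n) u) \<le> (1/2) ^ i" if "n \<le> L" for n
    proof -
      have "p i ((T ^^ n) u) \<le> C * p q u" using C that u by simp
      also have "\<dots> \<le> C * p k u" using q k u by (intro mult_left_mono seminorm_mono) auto
      also have "\<dots> = (1/2) ^ i" using pu[of k 0] k q pk by (simp add: c_def)
      finally show ?thesis .
    qed
    moreover have "\<forall>n\<ge>max S N. (T ^^ n) u = 0" using y by (auto simp: u_def pow_scale)
    ultimately show ?thesis using u k by (intro bexI[of _ u] exI[of _ N] conjI exI[of _ "max S N"]) auto
  qed
  \<comment> \<open>Block number \<open>j\<close> is built at level \<open>Suc j\<close>, as levels
    start at 1.\<close>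
  define P where "P = (\<lambda>j (u, N, S). u \<in> X \<and> N \<ge> (1::nat) \<and> S \<ge> N \<and> (\<forall>n\<ge>S. (T ^^ n) u = 0) \<and>
      real (card {n\<in>{1..N}. p m ((T ^^ n) u) \<le> real (Suc j)}) \<le> real N / real (Suc j))"
  \<comment> \<open>Being negligible up to \<open>Suc j * S\<close> leaves a quiet period much
    longer than the life \<open>S\<close> of the earlier blocks. The bound on \<open>N'\<close>
    makes the next active period dwarf \<open>S\<close>.\<close>
  define Q where "Q = (\<lambda>j (u :: 'b, N :: nat, S). \<lambda>(u', N', S' :: nat).
      (\<forall>n\<le>Suc j * S. p (Suc (Suc j)) ((T ^^ n) u') \<le> (1/2) ^ Suc (Suc j)) \<and> N' \<ge> Suc (Suc j) * S)"
  have "\<exists>f. \<forall>j. P j (f j) \<and> Q j (f j) (f (Suc j))"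
  proof (rule dependent_nat_choice)
    show "\<exists>s. P 0 s"
      using step[of 1 0] by (auto simp: P_def)
    fix s j assume "P j s"
    obtain u N S where s: "s = (u, N, S)" by (cases s) auto
    obtain u' N' S' where "u' \<in> X" "N' \<ge> Suc (Suc j) * S" "S' \<ge> N'" "N' \<ge> 1"
      "\<forall>n\<ge>S'. (T ^^ n) u' = 0"
      "\<forall>n\<le>Suc (Suc j) * S. p (Suc (Suc j)) ((T ^^ n) u') \<le> (1/2) ^ Suc (Suc j)"
      "real (card {n\<in>{1..N'}. p m ((T ^^ n) u') \<le> real (Suc (Suc j))}) \<le> real N' / real (Suc (Suc j))"
      using step[of "Suc (Suc j)" "Suc (Suc j) * S"] by auto
    moreover have "Suc j * S \<le> Suc (Suc j) * S" by simp
    ultimately have "P (Suc j) (u', N', S') \<and> Q j s (u', N', S')"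
      unfolding s P_def Q_def prod.case by (meson order_trans)
    then show "\<exists>s'. P (Suc j) s' \<and> Q j s s'" by blast
  qed
  then obtain f where f: "\<And>j. P j (f j)" "\<And>j. Q j (f j) (f (Suc j))" by blast
  define u where "u j = fst (f j)" for j
  define N where "N j = fst (snd (f j))" for j
  define S where "S j = snd (snd (f j))" for j
  have f_eq: "f j = (u j, N j, S j)" for j by (simp add: u_def N_def S_def)
  have u: "u j \<in> X" and N1: "N j \<ge> 1" and NS: "N j \<le> S j"
    and dies: "\<And>n. n \<ge> S j \<Longrightarrow> (T ^^ n) (u j) = 0"
    and card_u: "real (card {n\<in>{1..N j}. p m ((T ^^ n) (u j)) \<le> real (Suc j)}) \<le> real (N j) / real (Suc j)"
    for j using f(1)[of j] unfolding f_eq P_def by auto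
  have small_u: "\<And>n. n \<le> Suc j * S j \<Longrightarrow> p (Suc (Suc j)) ((T ^^ n) (u (Suc j))) \<le> (1/2) ^ Suc (Suc j)"
    and NSuc: "N (Suc j) \<ge> Suc (Suc j) * S j"
    for j using f(2)[of j] unfolding f_eq Q_def by auto
  have S_mono: "S i \<le> S j" if "i \<le> j" for i j
    using that
  proof (induction rule: dec_induct)
    case (step n)
    have "S n \<le> Suc (Suc n) * S n" by simp
    also have "\<dots> \<le> S (Suc n)" using NSuc[of n] NS[of "Suc n"] by linarith
    finally show ?case using step by simp
  qed simp
  define V where "V I = (\<Sum>i<I. u i)" for I
  have V_in: "V I \<in> X" for I unfolding V_def by (rule sum_in) (use u in auto)
  have V_dies: "(T ^^ n) (V (Suc j)) = 0" if "n \<ge> S j" for n j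
  proof -
    have "(T ^^ n) (u i) = 0" if "i < Suc j" for i
      using dies S_mono[of i j] that \<open>n \<ge> S j\<close> by simp
    then show ?thesis unfolding V_def using u by (subst pow_sum) (auto intro: sum.neutral)
  qed
  \<comment> \<open>The right-hand side is the exact sum of the bounds \<open>(1/2) ^ Suc i\<close>
    for \<open>I \<le> i < I'\<close>, which lets the induction telescope. It also yields the Cauchy
    property, at \<open>n = 0\<close>.\<close>
  have V_tail: "p (Suc j) ((T ^^ n) (V I' - V I)) \<le> (1/2) ^ I - (1/2) ^ I'"
    if jI: "Suc j \<le> I" and II: "I \<le> I'" and n: "n \<le> Suc j * S j" for j n I I'
    using II
  proof (induction rule: dec_induct)
    case (step i)
    obtain i' where i': "i = Suc i'" "j \<le> i'" using jI step.hyps by (cases i) auto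
    have "n \<le> Suc i' * S i'"
      using n mult_le_mono[OF _ S_mono, of "Suc j" "Suc i'" j i'] i' by linarith
    then have "p (Suc i) ((T ^^ n) (u i)) \<le> (1/2) ^ Suc i" using small_u[of n i'] i' by simp
    moreover have "p (Suc j) ((T ^^ n) (u i)) \<le> p (Suc i) ((T ^^ n) (u i))"
      using u i' by (intro seminorm_mono) auto
    moreover have "(T ^^ n) (V (Suc i) - V I) = (T ^^ n) (V i - V I) + (T ^^ n) (u i)"
    proof -
      have V_step: "V (Suc i) - V I = (V i - V I) + u i" by (simp add: V_def)
      show ?thesis unfolding V_step by (intro pow_add diff_in V_in u)
    qed
    moreover have "p (Suc j) ((T ^^ n) (V i - V I) + (T ^^ n) (u i))
        \<le> p (Suc j) ((T ^^ n) (V i - V I)) + p (Suc j) ((T ^^ n) (u i))"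
      using V_in u by (intro seminorm_triangle) auto
    ultimately show ?case using step.IH by (simp only:) simp
  qed simp
  obtain x where x: "x \<in> X" and lim: "\<And>k. k \<ge> 1 \<Longrightarrow> (\<lambda>I. p k (V I - x)) \<longlonglongrightarrow> 0"
  proof (rule seminorm_Cauchy_convergent[of V])
    fix k :: nat and \<eta> :: real assume k: "k \<ge> 1" and \<eta>: "\<eta> > 0"
    obtain I0 where I0: "(1/2::real) ^ I0 < \<eta>" using real_arch_pow_inv[of \<eta> "1/2"] \<eta> by auto
    have "p k (V I' - V I) < \<eta>" if "I \<ge> max k I0" "I' \<ge> I" for I I'
    proof -
      have "p k (V I' - V I) \<le> (1/2) ^ I - (1/2) ^ I'"
        using V_tail[of "k - 1" I I' 0] k that by simp
      also have "\<dots> \<le> (1/2) ^ I" by simp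
      also have "\<dots> \<le> (1/2) ^ I0" using that by (intro power_decreasing) auto
      finally show ?thesis using I0 by simp
    qed
    then show "\<exists>N. \<forall>n\<ge>N. \<forall>n'\<ge>n. p k (V n' - V n) < \<eta>" by blast
  qed (use V_in in auto)
  \<comment> \<open>The bound for partial sums passes to the limit \<open>x\<close>.\<close>
  have x_tail: "p (Suc j) ((T ^^ n) (x - V (Suc j))) \<le> (1/2) ^ Suc j"
    if "n \<le> Suc j * S j" for j n
  proof (rule LIMSEQ_le_const2)
    show "(\<lambda>I. p (Suc j) ((T ^^ n) (V I - V (Suc j)))) \<longlonglongrightarrow> p (Suc j) ((T ^^ n) (x - V (Suc j)))"
    proof (rule seminorm_tendsto)
      have "(\<lambda>I. p (Suc j) ((T ^^ n) (V I) - (T ^^ n) x)) \<longlonglongrightarrow> 0"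
        using V_in x lim by (intro pow_tendsto) auto
      then show "(\<lambda>I. p (Suc j) ((T ^^ n) (V I - V (Suc j)) - (T ^^ n) (x - V (Suc j)))) \<longlonglongrightarrow> 0"
        using V_in x by (simp add: pow_diff)
    qed (use V_in x in auto)
    have "p (Suc j) ((T ^^ n) (V I - V (Suc j))) \<le> (1/2) ^ Suc j" if "I \<ge> Suc j" for I
    proof -
      have "p (Suc j) ((T ^^ n) (V I - V (Suc j))) \<le> (1/2) ^ Suc j - (1/2) ^ I"
        using V_tail[of j "Suc j" I n] that \<open>n \<le> Suc j * S j\<close> by blast
      also have "\<dots> \<le> (1/2) ^ Suc j" by simp
      finally show ?thesis .
    qed
    then show "\<exists>M. \<forall>I\<ge>M. p (Suc j) ((T ^^ n) (V I - V (Suc j))) \<le> (1/2) ^ Suc j" by blast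
  qed
  have split: "(T ^^ n) x = (T ^^ n) (x - V (Suc j))" if "n \<ge> S j" for n j
    using V_dies[OF that] V_in x by (simp add: pow_diff)
  \<comment> \<open>Between \<open>S j\<close> and \<open>Suc j * S j\<close> the blocks up to
    \<open>j\<close> are dead and the rest is tiny. Bad times thus have share at most
    \<open>1 / Suc j\<close>.\<close>
  have count_small: "card {n\<in>{1..Suc j * S j}. (1/2) ^ j \<le> p (Suc j) ((T ^^ n) x)} \<le> S j" for j
  proof -
    have "{n\<in>{1..Suc j * S j}. (1/2) ^ j \<le> p (Suc j) ((T ^^ n) x)} \<subseteq> {1..S j}"
    proof safe
      fix n assume n: "n \<in> {1..Suc j * S j}" and ge: "(1/2) ^ j \<le> p (Suc j) ((T ^^ n) x)"
      have "\<not> n \<ge> S j"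
      proof
        assume "n \<ge> S j"
        then have "p (Suc j) ((T ^^ n) x) \<le> (1/2) ^ Suc j"
          using split[of j n] x_tail[of n j] n by simp
        also have "\<dots> < (1/2) ^ j" by simp
        finally show False using ge by simp
      qed
      then show "n \<in> {1..S j}" using n by simp
    qed
    from card_mono[OF _ this] show ?thesis by simp
  qed
  \<comment> \<open>After \<open>S j\<close> the orbit is that of \<open>u (Suc j)\<close> plus a
    tail of size at most 1 in \<open>p m\<close>, which costs one unit of the threshold. The early
    times and the bad times of \<open>u (Suc j)\<close> each contribute a share of at most
    \<open>1 / Suc (Suc j)\<close>.\<close>
  have count_large: "real (card {n\<in>{1..N (Suc j)}. p m ((T ^^ n) x) \<le> real (Suc j)})
      \<le> 2 * real (N (Suc j)) / real (Suc (Suc j))" if jm: "j \<ge> m" for j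
  proof -
    let ?B = "{n\<in>{1..N (Suc j)}. p m ((T ^^ n) (u (Suc j))) \<le> real (Suc (Suc j))}"
    have "{n\<in>{1..N (Suc j)}. p m ((T ^^ n) x) \<le> real (Suc j)} \<subseteq> {1..S j} \<union> ?B"
    proof safe
      fix n assume n: "n \<in> {1..N (Suc j)}" and le: "p m ((T ^^ n) x) \<le> real (Suc j)"
        and "n \<notin> {1..S j}"
      then have nS: "n \<ge> S j" by simp
      have "n \<le> S (Suc j)" using n NS[of "Suc j"] by simp
      then have "n \<le> Suc (Suc j) * S (Suc j)" by simp
      from x_tail[OF this]
      have "p (Suc (Suc j)) ((T ^^ n) (x - V (Suc (Suc j)))) \<le> (1/2) ^ Suc (Suc j)" .
      also have "\<dots> \<le> 1" by (rule power_le_one) auto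
      finally have "p m ((T ^^ n) (x - V (Suc (Suc j)))) \<le> 1"
        using seminorm_mono[of m "Suc (Suc j)" "(T ^^ n) (x - V (Suc (Suc j)))"] m jm x V_in by simp
      moreover have "(T ^^ n) x = (T ^^ n) (u (Suc j)) + (T ^^ n) (x - V (Suc (Suc j)))"
        using V_dies[OF nS] V_in x u by (simp add: V_def pow_diff pow_add)
      moreover have "p m ((T ^^ n) (u (Suc j))) - p m ((T ^^ n) (x - V (Suc (Suc j))))
          \<le> p m ((T ^^ n) (u (Suc j)) + (T ^^ n) (x - V (Suc (Suc j))))"
        using m u x V_in by (intro seminorm_add_lower) auto
      ultimately show "p m ((T ^^ n) (u (Suc j))) \<le> real (Suc (Suc j))" using le by simp
    qed
    then have "card {n\<in>{1..N (Suc j)}. p m ((T ^^ n) x) \<le> real (Suc j)} \<le> card ({1..S j} \<union> ?B)"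
      by (intro card_mono) auto
    also have "\<dots> \<le> S j + card ?B" using card_Un_le[of "{1..S j}" ?B] by simp
    finally have "real (card {n\<in>{1..N (Suc j)}. p m ((T ^^ n) x) \<le> real (Suc j)})
        \<le> real (S j) + real (card ?B)" by (simp only: of_nat_le_iff flip: of_nat_add)
    also have "real (S j) \<le> real (N (Suc j)) / real (Suc (Suc j))"
    proof -
      have "real (Suc (Suc j)) * real (S j) \<le> real (N (Suc j))"
        using NSuc[of j] by (simp only: of_nat_le_iff flip: of_nat_mult)
      then show ?thesis by (simp add: field_simps)
    qed
    also have "real (card ?B) \<le> real (N (Suc j)) / real (Suc (Suc j))" by (rule card_u)
    finally show ?thesis by simp
  qed
  have S1: "S j \<ge> 1" for j using N1[of j] NS[of j] by linarith
  have "distributionally_irregular m x"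
    unfolding distributionally_irregular_def
  proof (intro conjI allI impI)
    fix A c :: real and K :: nat assume c: "c > 0"
    \<comment> \<open>One large \<open>j\<close> meets all demands: threshold \<open>A\<close>,
      share \<open>2 / (j + 2) < c\<close>, lateness \<open>K\<close>, and \<open>j \<ge> m\<close>
      for \<open>count_large\<close>.\<close>
    obtain j :: nat where j: "real j \<ge> \<bar>A\<bar> + 2 / c + real K + real m" using real_arch_simple by blast
    have "2 / c > 0" using c by simp
    with j have jb: "real j \<ge> A" "real j \<ge> 2 / c" "j \<ge> K" "j \<ge> m" by linarith+
    have "Suc (Suc j) * 1 \<le> Suc (Suc j) * S j" using S1 by (intro mult_le_mono) auto
    also have "\<dots> \<le> N (Suc j)" by (rule NSuc)
    finally have NK: "N (Suc j) \<ge> K" using jb by simp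
    have "card {n\<in>{1..N (Suc j)}. p m ((T ^^ n) x) \<le> A}
        \<le> card {n\<in>{1..N (Suc j)}. p m ((T ^^ n) x) \<le> real (Suc j)}"
      using jb by (intro card_mono) auto
    then have "real (card {n\<in>{1..N (Suc j)}. p m ((T ^^ n) x) \<le> A})
        \<le> 2 * real (N (Suc j)) / real (Suc (Suc j))"
      using count_large[of j] jb by linarith
    also have "\<dots> < c * real (N (Suc j))"
    proof -
      have "2 / c < real (Suc (Suc j))" using jb by simp
      then have "2 < c * real (Suc (Suc j))" using c by (simp add: field_simps)
      then have "2 * real (N (Suc j)) < c * real (Suc (Suc j)) * real (N (Suc j))"
        using N1[of "Suc j"] by (intro mult_strict_right_mono) auto
      then show ?thesis by (simp add: field_simps)
    qed
    finally show "\<exists>k\<ge>K. k \<ge> 1 \<and> real (card {n\<in>{1..k}. p m ((T ^^ n) x) \<le> A}) < c * real k"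
      using N1[of "Suc j"] NK by blast
  next
    fix l K :: nat and \<eta> c :: real assume l: "l \<ge> 1" and \<eta>: "\<eta> > 0" and c: "c > 0"
    obtain j0 where j0: "(1/2::real) ^ j0 < \<eta>" using real_arch_pow_inv[of \<eta> "1/2"] \<eta> by auto
    obtain j :: nat where j: "real j \<ge> real j0 + 1 / c + real K + real l" using real_arch_simple by blast
    have "1 / c > 0" using c by simp
    with j have jb: "j \<ge> j0" "real j \<ge> 1 / c" "j \<ge> K" "j \<ge> l" by linarith+
    have "(1/2::real) ^ j \<le> (1/2) ^ j0" using jb by (intro power_decreasing) auto
    then have j\<eta>: "(1/2::real) ^ j < \<eta>" using j0 by linarith
    have "card {n\<in>{1..Suc j * S j}. \<eta> \<le> p l ((T ^^ n) x)}
        \<le> card {n\<in>{1..Suc j * S j}. (1/2) ^ j \<le> p (Suc j) ((T ^^ n) x)}"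
    proof (intro card_mono subsetI)
      fix n assume n: "n \<in> {n\<in>{1..Suc j * S j}. \<eta> \<le> p l ((T ^^ n) x)}"
      have "p l ((T ^^ n) x) \<le> p (Suc j) ((T ^^ n) x)"
        using l jb x by (intro seminorm_mono) auto
      then show "n \<in> {n\<in>{1..Suc j * S j}. (1/2) ^ j \<le> p (Suc j) ((T ^^ n) x)}"
        using n j\<eta> by auto
    qed simp
    then have "real (card {n\<in>{1..Suc j * S j}. \<eta> \<le> p l ((T ^^ n) x)}) \<le> real (S j)"
      using count_small[of j] by linarith
    also have "\<dots> < c * real (Suc j * S j)"
    proof -
      have "1 / c < real (Suc j)" using jb by simp
      then have "1 < c * real (Suc j)" using c by (simp add: field_simps)
      then have "1 * real (S j) < c * real (Suc j) * real (S j)"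
        using S1[of j] by (intro mult_strict_right_mono) auto
      then show ?thesis by (simp only: of_nat_mult mult.assoc mult_1)
    qed
    finally have "real (card {n\<in>{1..Suc j * S j}. \<eta> \<le> p l ((T ^^ n) x)}) < c * real (Suc j * S j)" .
    moreover have "Suc j * 1 \<le> Suc j * S j" using S1 by (intro mult_le_mono) auto
    ultimately show "\<exists>k\<ge>K. k \<ge> 1 \<and> real (card {n\<in>{1..k}. \<eta> \<le> p l ((T ^^ n) x)}) < c * real k"
      using jb by (intro exI[of _ "Suc j * S j"]) auto
  qed (use m x in auto)
  then show ?thesis by blast
qed

section \<open>Growth along orbits of a chaotic operator\<close>

text \<open>The seminorm \<open>m\<close> depends only on \<open>\<epsilon>\<close> and is fixed
  before \<open>l\<close>, \<open>c\<close> and \<open>K\<close>. Restarting the orbit of a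
  difference at a time when it is tiny in \<open>p l\<close> makes the later size in
  \<open>p m\<close> large in proportion.\<close>

lemma distributionally_chaotic_imp_growth:
  assumes "distributionally_chaotic X d T"
  obtains m where "m \<ge> 1"
    "\<And>l c K. l \<ge> m \<Longrightarrow> c \<ge> 1 \<Longrightarrow> \<exists>N\<ge>K. \<exists>z\<in>X. 0 < p l z \<and>
      real (card {n\<in>{1..N}. p m ((T ^^ n) z) / p l z > c}) > (1 - 1 / c) * real N"
proof -
  obtain \<Gamma> \<epsilon> where \<Gamma>: "\<Gamma> \<subseteq> X" "\<epsilon> > 0" "uncountable \<Gamma>"
    and scr: "\<And>x y. x \<in> \<Gamma> \<Longrightarrow> y \<in> \<Gamma> \<Longrightarrow> x \<noteq> y \<Longrightarrow>
      liminf (\<lambda>k. ereal (real (card {n\<in>{1..k}. d ((T ^^ n) x) ((T ^^ n) y) < \<epsilon>}) / real k)) = 0 \<and>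
      (\<forall>\<tau>>0. limsup (\<lambda>k. ereal (real (card {n\<in>{1..k}. d ((T ^^ n) x) ((T ^^ n) y) < \<tau>}) / real k)) = 1)"
    using assms unfolding distributionally_chaotic_def by blast
  have "infinite \<Gamma>" using \<Gamma>(3) countable_finite by blast
  then obtain x where x: "x \<in> \<Gamma>" by fastforce
  have "\<not> \<Gamma> \<subseteq> {x}" using \<open>infinite \<Gamma>\<close> finite_subset by blast
  then obtain y where y: "y \<in> \<Gamma>" "x \<noteq> y" by blast
  have xX: "x \<in> X" and yX: "y \<in> X" using \<Gamma> x y by auto
  define u where "u = x - y"
  have u: "u \<in> X" using xX yX by (simp add: u_def)
  have u_pow: "(T ^^ n) u = (T ^^ n) x - (T ^^ n) y" for n
    using xX yX by (simp add: u_def pow_diff)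
  have far: "\<And>c K. c > 0 \<Longrightarrow> \<exists>k\<ge>K. k \<ge> 1 \<and>
      real (card {n\<in>{1..k}. d ((T ^^ n) x) ((T ^^ n) y) < \<epsilon>}) < c * real k"
    using scr[OF x y] unfolding liminf_density_eq_0_iff by blast
  have near: "\<And>\<tau> c K. \<tau> > 0 \<Longrightarrow> c > 0 \<Longrightarrow> \<exists>k\<ge>K. k \<ge> 1 \<and>
      real (card {n\<in>{1..k}. \<not> d ((T ^^ n) x) ((T ^^ n) y) < \<tau>}) < c * real k"
    using scr[OF x y] unfolding limsup_density_eq_1_iff by blast
  \<comment> \<open>By contraposition, distance at least \<open>\<epsilon>\<close> forces
    \<open>p m\<close> of the difference to be at least \<open>\<epsilon> / 2\<close>.\<close>
  obtain m where m: "m \<ge> 1"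
    "\<And>x y. x \<in> X \<Longrightarrow> y \<in> X \<Longrightarrow> p m (x - y) < \<epsilon> / 2 \<Longrightarrow> d x y < \<epsilon>"
    using dist_less_if_seminorm_less[OF \<Gamma>(2)] by blast
  define \<delta> where "\<delta> = \<epsilon> / 2"
  have \<delta>: "\<delta> > 0" using \<Gamma> by (simp add: \<delta>_def)
  show ?thesis
  proof (rule that[OF m(1)])
    fix l K :: nat and c :: real assume l: "l \<ge> m" and c: "c \<ge> 1"
    have l1: "l \<ge> 1" using l m by simp
    \<comment> \<open>Below, \<open>p l z < 2 * \<eta>\<close> and
      \<open>p m ((T ^^ n) z) \<ge> \<delta> - \<eta>\<close>. The factor 4 gives
      \<open>c * p l z < \<delta> / 2\<close>, below \<open>3 * \<delta> / 4\<close>. The cap 1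
      permits the passage from distance to seminorm.\<close>
    define \<eta> where "\<eta> = min 1 (\<delta> / (4 * c))"
    have \<eta>: "\<eta> > 0" "\<eta> \<le> 1" "\<eta> \<le> \<delta> / (4 * c)" using \<delta> c by (auto simp: \<eta>_def)
    have "(1/2) ^ l * \<eta> > 0" using \<eta> by simp
    then obtain k where k: "k \<ge> 1"
      "real (card {n\<in>{1..k}. \<not> d ((T ^^ n) x) ((T ^^ n) y) < (1/2) ^ l * \<eta>}) < 1 * real k"
      using near[of "(1/2) ^ l * \<eta>" 1 0] by auto
    have "\<exists>j\<in>{1..k}. d ((T ^^ j) x) ((T ^^ j) y) < (1/2) ^ l * \<eta>"
    proof (rule ccontr)
      assume "\<not> ?thesis"
      then have "{n\<in>{1..k}. \<not> d ((T ^^ n) x) ((T ^^ n) y) < (1/2) ^ l * \<eta>} = {1..k}" by auto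
      then show False using k by simp
    qed
    then obtain j where "d ((T ^^ j) x) ((T ^^ j) y) < (1/2) ^ l * \<eta>" by blast
    then have pj: "p l ((T ^^ j) u) < \<eta>"
      using seminorm_less_if_dist_less[OF l1, of "(T ^^ j) x" "(T ^^ j) y" \<eta>] \<eta> xX yX
      by (simp add: u_pow)
    define z0 where "z0 = (T ^^ j) u"
    have z0: "z0 \<in> X" using u by (simp add: z0_def)
    \<comment> \<open>With \<open>k' > 2 * j\<close>, discarding the first \<open>j\<close> times at
      most halves the interval. The factor 2 in \<open>1 / (2 * c)\<close> pays for that.\<close>
    obtain k' where k': "k' \<ge> K + 2 * j + 1"
      "real (card {n\<in>{1..k'}. d ((T ^^ n) x) ((T ^^ n) y) < \<epsilon>}) < 1 / (2 * c) * real k'"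
      using far[of "1 / (2 * c)" "K + 2 * j + 1"] c by auto
    define N where "N = k' - j"
    have N: "N \<ge> K" "N \<ge> 1" "k' \<le> 2 * N" "k' = N + j" using k' by (auto simp: N_def)
    define G where "G = {n\<in>{1..N}. \<delta> \<le> p m ((T ^^ n) z0)}"
    have G: "real (card G) > (1 - 1 / c) * real N"
    proof -
      let ?B = "{n\<in>{1..N}. \<not> \<delta> \<le> p m ((T ^^ n) z0)}"
      have "(\<lambda>n. n + j) ` ?B \<subseteq> {n\<in>{1..k'}. d ((T ^^ n) x) ((T ^^ n) y) < \<epsilon>}"
      proof safe
        fix n assume n: "n \<in> {1..N}" and lt: "\<not> \<delta> \<le> p m ((T ^^ n) z0)"
        show "n + j \<in> {1..k'}" using n N by auto
        have "(T ^^ n) z0 = (T ^^ (n + j)) u" by (simp add: z0_def funpow_add)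
        then have "p m ((T ^^ (n + j)) x - (T ^^ (n + j)) y) < \<epsilon> / 2"
          using lt by (simp add: u_pow \<delta>_def not_le)
        then show "d ((T ^^ (n + j)) x) ((T ^^ (n + j)) y) < \<epsilon>" using m(2) xX yX by simp
      qed
      then have "card ((\<lambda>n. n + j) ` ?B) \<le> card {n\<in>{1..k'}. d ((T ^^ n) x) ((T ^^ n) y) < \<epsilon>}"
        by (intro card_mono) auto
      then have "card ?B \<le> card {n\<in>{1..k'}. d ((T ^^ n) x) ((T ^^ n) y) < \<epsilon>}"
        by (subst (asm) card_image) auto
      then have "real (card ?B) < 1 / (2 * c) * real k'" using k'(2) by linarith
      also have "\<dots> \<le> 1 / (2 * c) * real (2 * N)"
        using N c by (intro mult_left_mono) (simp_all only: of_nat_le_iff, auto)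
      also have "\<dots> = real N / c" by simp
      finally have "real (card ?B) < real N / c" .
      moreover have "real (card G) = real N - real (card ?B)"
        using card_filter_add_card_filter_not[of N "\<lambda>n. \<delta> \<le> p m ((T ^^ n) z0)"]
        unfolding G_def by linarith
      ultimately show ?thesis by (simp add: algebra_simps)
    qed
    \<comment> \<open>A nonempty \<open>G\<close> supplies an orbit point of size at least
      \<open>\<delta>\<close> in \<open>p m\<close>, hence in \<open>p l\<close> because
      \<open>l \<ge> m\<close>.\<close>
    have "(1 - 1 / c) * real N \<ge> 0" using c by simp
    with G have "G \<noteq> {}" by auto
    then obtain n0 where n0: "\<delta> \<le> p m ((T ^^ n0) z0)" by (auto simp: G_def)
    \<comment> \<open>If \<open>z0\<close> lies in the kernel of \<open>p l\<close>, a small multiple of \<open>v\<close> moves it out.\<close>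
    define v where "v = (T ^^ n0) z0"
    have v: "v \<in> X" using z0 by (simp add: v_def)
    have pv: "p l v > 0" using n0 \<delta> seminorm_mono[OF m(1) l v] by (simp add: v_def)
    \<comment> \<open>\<open>A\<close> dominates \<open>p l v\<close> and every relevant
      \<open>p m ((T ^^ n) v)\<close>, so a perturbation by \<open>\<eta> / A\<close> times
      \<open>v\<close> changes each of these seminorms by at most \<open>\<eta>\<close>.\<close>
    define A where "A = p l v + (\<Sum>n=1..N. p m ((T ^^ n) v))"
    have A: "p l v \<le> A" "\<And>n. n \<in> {1..N} \<Longrightarrow> p m ((T ^^ n) v) \<le> A"
    proof -
      have nn: "p m ((T ^^ n) v) \<ge> 0" for n using seminorm_nonneg m v by simp
      then show "p l v \<le> A" by (simp add: A_def sum_nonneg)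
      show "p m ((T ^^ n) v) \<le> A" if "n \<in> {1..N}" for n
        using member_le_sum[OF that, of "\<lambda>n. p m ((T ^^ n) v)"] nn pv by (simp add: A_def)
    qed
    have A0: "A > 0" using A pv by linarith
    define s where "s = (if p l z0 = 0 then \<eta> / A else 0)"
    have s: "s \<ge> 0" "s * A \<le> \<eta>" using \<eta> A0 by (auto simp: s_def)
    define z where "z = z0 + smul (of_real s) v"
    have z: "z \<in> X" using z0 v by (simp add: z_def)
    have z0_nn: "p l z0 \<ge> 0" using seminorm_nonneg l1 z0 by simp
    have p_sv: "p i (smul (of_real s) ((T ^^ n) v)) = s * p i ((T ^^ n) v)" if "i \<ge> 1" for i n
      using seminorm_scale[OF that] v s by simp
    have sv: "p l (smul (of_real s) v) = s * p l v" using p_sv[of l 0] l1 by simp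
    have "s * p l v \<le> s * A" using s A by (intro mult_left_mono) auto
    then have "p l z < 2 * \<eta>"
      using seminorm_triangle[OF l1 z0, of "smul (of_real s) v"] pj s v sv
      by (simp add: z_def z0_def)
    have pz: "0 < p l z"
    proof (cases "p l z0 = 0")
      case True
      have "s > 0" using True \<eta> A0 by (simp add: s_def)
      then have "0 < s * p l v" using pv by simp
      also have "\<dots> - p l z0 \<le> p l z"
        using seminorm_add_lower[OF l1 _ z0, of "smul (of_real s) v"] v sv
        by (simp add: z_def add.commute)
      finally show ?thesis using True by simp
    next
      case False
      then show ?thesis using z0_nn by (simp add: z_def s_def)
    qed
    have large: "p m ((T ^^ n) z) / p l z > c" if n: "n \<in> G" for n
    proof -
      have "c * \<eta> \<le> c * (\<delta> / (4 * c))" using \<eta> c by (intro mult_left_mono) auto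
      then have c\<eta>: "c * \<eta> \<le> \<delta> / 4" using c by simp
      moreover have "1 * \<eta> \<le> c * \<eta>" using c \<eta> by (intro mult_right_mono) auto
      ultimately have "\<eta> \<le> \<delta> / 4" by simp
      have "s * p m ((T ^^ n) v) \<le> s * A" using s A n by (intro mult_left_mono) (auto simp: G_def)
      then have "s * p m ((T ^^ n) v) \<le> \<eta>" using s by linarith
      moreover have z_pow: "(T ^^ n) z = (T ^^ n) z0 + smul (of_real s) ((T ^^ n) v)"
        using z0 v by (simp add: z_def pow_add pow_scale)
      moreover have "p m ((T ^^ n) z0) - p m (smul (of_real s) ((T ^^ n) v)) \<le> p m ((T ^^ n) z)"
        unfolding z_pow using z0 v m by (intro seminorm_add_lower) auto
      moreover have "\<delta> \<le> p m ((T ^^ n) z0)" using n by (simp add: G_def)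
      ultimately have "p m ((T ^^ n) z) \<ge> \<delta> - \<eta>" using p_sv[OF m(1), of n] by linarith
      moreover have "c * p l z < c * (2 * \<eta>)"
        using c \<open>p l z < 2 * \<eta>\<close> by (intro mult_strict_left_mono) auto
      ultimately have "c * p l z < p m ((T ^^ n) z)" using c\<eta> \<open>\<eta> \<le> \<delta> / 4\<close> \<delta> by linarith
      then show ?thesis using pz by (simp add: field_simps)
    qed
    have "card G \<le> card {n\<in>{1..N}. p m ((T ^^ n) z) / p l z > c}"
      using large by (intro card_mono) (auto simp: G_def)
    then have "real (card {n\<in>{1..N}. p m ((T ^^ n) z) / p l z > c}) > (1 - 1 / c) * real N"
      using G by linarith
    then show "\<exists>N\<ge>K. \<exists>z\<in>X. 0 < p l z \<and>
      real (card {n\<in>{1..N}. p m ((T ^^ n) z) / p l z > c}) > (1 - 1 / c) * real N"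
      using N z pz by blast
  qed
qed

text \<open>Only finitely many strict inequalities are involved, and the quotients converge because
  \<open>p l z\<close> is positive, so all of them survive for late \<open>M\<close>.\<close>

lemma growth_of_approximation:
  assumes "\<And>n. \<sigma> n \<in> X" "z \<in> X" "limitin (frechet_topology X p) \<sigma> z sequentially"
    and "m \<ge> 1" "l \<ge> 1" "0 < p l z"
  shows "\<forall>\<^sub>F M in sequentially. 0 < p l (\<sigma> M) \<and>
    card {n\<in>{1..N}. p m ((T ^^ n) z) / p l z > c} \<le> card {n\<in>{1..N}. p m ((T ^^ n) (\<sigma> M)) / p l (\<sigma> M) > c}"
proof -
  have lim: "\<And>k. k \<ge> 1 \<Longrightarrow> (\<lambda>M. p k (\<sigma> M - z)) \<longlonglongrightarrow> 0"
    using limitin_iff[of \<sigma> z] assms(1,2,3) by blast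
  have lim_l: "(\<lambda>M. p l (\<sigma> M)) \<longlonglongrightarrow> p l z"
    using assms lim by (intro seminorm_tendsto) auto
  have "(\<lambda>M. p m ((T ^^ n) (\<sigma> M))) \<longlonglongrightarrow> p m ((T ^^ n) z)" for n
    using assms lim by (intro seminorm_tendsto pow_tendsto) auto
  then have lim_quot: "(\<lambda>M. p m ((T ^^ n) (\<sigma> M)) / p l (\<sigma> M)) \<longlonglongrightarrow> p m ((T ^^ n) z) / p l z" for n
    using lim_l assms(6) by (intro tendsto_divide) auto
  have "\<forall>\<^sub>F M in sequentially. \<forall>n\<in>{n\<in>{1..N}. p m ((T ^^ n) z) / p l z > c}.
      p m ((T ^^ n) (\<sigma> M)) / p l (\<sigma> M) > c"
    using order_tendstoD(1)[OF lim_quot] by (intro eventually_ball_finite) auto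
  moreover have "\<forall>\<^sub>F M in sequentially. 0 < p l (\<sigma> M)"
    using lim_l assms(6) by (rule order_tendstoD)
  ultimately show ?thesis
  proof eventually_elim
    case (elim M)
    then have "{n\<in>{1..N}. p m ((T ^^ n) z) / p l z > c} \<subseteq> {n\<in>{1..N}. p m ((T ^^ n) (\<sigma> M)) / p l (\<sigma> M) > c}"
      by blast
    from card_mono[OF _ this] elim show ?case by simp
  qed
qed

end

subsection \<open>Weighted backward shifts\<close>

lemma seq_scale_simps [simp]:
  fixes c :: "'a::mult_zero"
  shows "seq_scale 0 x = (0 :: nat \<Rightarrow> 'a)" "seq_scale c 0 = 0"
  by (simp_all add: seq_scale_def fun_eq_iff)

lemma canonical_vec_0 [simp]: "canonical_vec 0 = 0"
  by (auto simp: canonical_vec_def)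

text \<open>The hypothesis on \<open>w 0\<close> matters for \<open>i = 1\<close>, where the shift
  would otherwise leave a nonzero entry at index \<open>0\<close>.\<close>

lemma weighted_shift_canonical:
  fixes w :: "nat \<Rightarrow> 'a::comm_ring_1"
  assumes "w 0 = 0"
  shows "weighted_shift w (seq_scale c (canonical_vec i)) = seq_scale (c * w (i - 1)) (canonical_vec (i - 1))"
  using assms
  by (auto simp: weighted_shift_def seq_scale_def canonical_vec_def fun_eq_iff Suc_le_eq not_less_eq)

lemma weighted_shift_pow_canonical:
  fixes w :: "nat \<Rightarrow> 'a::comm_ring_1"
  assumes "w 0 = 0"
  shows "(weighted_shift w ^^ n) (seq_scale c (canonical_vec i)) =
    seq_scale (c * (\<Prod>t=1..n. w (i - t))) (canonical_vec (i - n))"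
  by (induction n) (simp_all add: weighted_shift_canonical[where w = w, OF assms] mult.assoc)

theorem theorem14:
  fixes X :: "(nat \<Rightarrow> 'a::{real_normed_field,banach}) set"
    and p :: "nat \<Rightarrow> (nat \<Rightarrow> 'a) \<Rightarrow> real"
    and w :: "nat \<Rightarrow> 'a"
  assumes "frechet_seq_space X p"
    and "canonical_basis X p"
    and "w \<in> scalar_seqs" and "\<forall>n\<ge>1. w n \<noteq> 0"
    and "weighted_shift w \<in> X \<rightarrow> X"
    and "continuous_map (frechet_topology X p) (frechet_topology X p) (weighted_shift w)"
  shows "distributionally_chaotic X (frechet_dist X p) (weighted_shift w) \<longleftrightarrow>
    (\<exists>m\<ge>1. \<exists>N :: nat \<Rightarrow> nat.
       strict_mono_on {1..} N \<and> (\<forall>k\<ge>1. 1 \<le> N k) \<and>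
       (\<forall>k\<ge>1. \<exists>r\<ge>1. \<exists>(i :: nat \<Rightarrow> nat) (b :: nat \<Rightarrow> 'a).
          (\<forall>j\<in>{1..r}. 1 \<le> i j \<and> b j \<noteq> 0) \<and>
          (let y = (\<Sum>j=1..r. seq_scale (b j) (canonical_vec (i j)));
               q = p (if k \<le> m then m else k)
           in q y \<noteq> 0 \<and>
              real (card {n\<in>{1..N k}.
                 p m (\<Sum>j=1..r. seq_scale (b j * (\<Prod>t=1..n. w (i j - t)))
                                  (canonical_vec (i j - n))) / q y > real k})
                > (1 - 1 / real k) * real (N k))))"
    (is "?chaotic \<longleftrightarrow> ?condition")
proof
  let ?B = "weighted_shift w"
  interpret frechet_operator seq_scale X p ?B
    using assms
    by unfold_locales (auto simp: frechet_seq_space_def weighted_shift_def seq_scale_def fun_eq_iff algebra_simps)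
  have w0: "w 0 = 0" using assms(3) by (simp add: scalar_seqs_def)
  have e_in: "seq_scale c (canonical_vec n) \<in> X" for c n
    using assms(2) by (cases "n = 0") (auto simp: canonical_basis_def)
  have sum_e_in: "(\<Sum>j\<in>J. seq_scale (b j) (canonical_vec (i j))) \<in> X"
    for J :: "nat set" and b i by (intro sum_in e_in)
  \<comment> \<open>This identifies the sums in the condition with the orbit of the finite
    combination \<open>y\<close>.\<close>
  have pow_sum_e: "(?B ^^ n) (\<Sum>j\<in>J. seq_scale (b j) (canonical_vec (i j))) =
      (\<Sum>j\<in>J. seq_scale (b j * (\<Prod>t=1..n. w (i j - t))) (canonical_vec (i j - n)))"
    for n J and b :: "nat \<Rightarrow> 'a" and i
    by (simp add: pow_sum e_in weighted_shift_pow_canonical[where w = w, OF w0])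
  {
    assume ?chaotic
    then obtain m where m: "m \<ge> 1"
      and growth: "\<And>l c K. l \<ge> m \<Longrightarrow> c \<ge> 1 \<Longrightarrow> \<exists>N\<ge>K. \<exists>z\<in>X. 0 < p l z \<and>
        real (card {n\<in>{1..N}. p m ((?B ^^ n) z) / p l z > c}) > (1 - 1 / c) * real N"
      using distributionally_chaotic_imp_growth by blast
    define good where "good = (\<lambda>k N. \<exists>r\<ge>1. \<exists>(i :: nat \<Rightarrow> nat) (b :: nat \<Rightarrow> 'a).
          (\<forall>j\<in>{1..r}. 1 \<le> i j \<and> b j \<noteq> 0) \<and>
          (let y = (\<Sum>j=1..r. seq_scale (b j) (canonical_vec (i j)));
               q = p (if k \<le> m then m else k)
           in q y \<noteq> 0 \<and>
              real (card {n\<in>{1..N}.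
                 p m (\<Sum>j=1..r. seq_scale (b j * (\<Prod>t=1..n. w (i j - t)))
                                  (canonical_vec (i j - n))) / q y > real k})
                > (1 - 1 / real k) * real N))"
    have ex_good: "\<exists>N\<ge>K. good k N" if k: "k \<ge> 1" for k K
    proof -
      \<comment> \<open>The seminorm index prescribed by the condition is never below
        \<open>m\<close>, as the growth statement requires.\<close>
      define l where "l = (if k \<le> m then m else k)"
      have l: "l \<ge> m" "l \<ge> 1" using m by (auto simp: l_def)
      obtain N z where N: "N \<ge> K" and z: "z \<in> X" "0 < p l z"
        and card: "real (card {n\<in>{1..N}. p m ((?B ^^ n) z) / p l z > real k}) > (1 - 1 / real k) * real N"
        using growth[OF l(1), of "real k" K] k by auto
      define \<sigma> where "\<sigma> M = (\<Sum>n=1..M. seq_scale (z n) (canonical_vec n))" for M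
      have "limitin (frechet_topology X p) \<sigma> z sequentially"
        using assms(2) z by (simp add: canonical_basis_def \<sigma>_def[abs_def])
      moreover have "\<sigma> M \<in> X" for M unfolding \<sigma>_def by (rule sum_e_in)
      ultimately have "\<forall>\<^sub>F M in sequentially. 0 < p l (\<sigma> M) \<and>
          card {n\<in>{1..N}. p m ((?B ^^ n) z) / p l z > real k}
          \<le> card {n\<in>{1..N}. p m ((?B ^^ n) (\<sigma> M)) / p l (\<sigma> M) > real k}"
        using z m l by (intro growth_of_approximation) auto
      then obtain M where M: "0 < p l (\<sigma> M)"
          "card {n\<in>{1..N}. p m ((?B ^^ n) z) / p l z > real k}
            \<le> card {n\<in>{1..N}. p m ((?B ^^ n) (\<sigma> M)) / p l (\<sigma> M) > real k}"
        using eventually_happens'[OF sequentially_bot] by blast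
      \<comment> \<open>Vanishing coefficients are dropped, since the condition asks for nonzero
        scalars. The support is nonempty because \<open>p l (\<sigma> M)\<close> is
        positive.\<close>
      define F where "F = {n\<in>{1..M}. z n \<noteq> 0}"
      have "finite F" by (simp add: F_def)
      then obtain i where i: "bij_betw i {1..card F} F" using ex_bij_betw_nat_finite_1 by blast
      have "\<sigma> M = (\<Sum>n\<in>F. seq_scale (z n) (canonical_vec n))"
        unfolding \<sigma>_def F_def by (intro sum.mono_neutral_right) auto
      also have "\<dots> = (\<Sum>j=1..card F. seq_scale (z (i j)) (canonical_vec (i j)))"
        using sum.reindex_bij_betw[OF i] by (rule sym)
      finally have y: "\<sigma> M = (\<Sum>j=1..card F. seq_scale (z (i j)) (canonical_vec (i j)))" .
      have "card F \<ge> 1"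
      proof (rule ccontr)
        assume "\<not> card F \<ge> 1"
        then have "\<sigma> M = 0" using y by simp
        then show False using M l by simp
      qed
      moreover have "\<forall>j\<in>{1..card F}. 1 \<le> i j \<and> z (i j) \<noteq> 0"
        using bij_betwE[OF i] by (auto simp: F_def)
      moreover have "real (card {n\<in>{1..N}. p m ((?B ^^ n) (\<sigma> M)) / p l (\<sigma> M) > real k})
          > (1 - 1 / real k) * real N"
        using card M by linarith
      ultimately have "good k N"
        using M(1) unfolding good_def Let_def pow_sum_e[symmetric] y l_def
        by (intro exI[of _ "card F"] conjI exI[of _ i] exI[of _ "\<lambda>j. z (i j)"]) auto
      then show ?thesis using N by blast
    qed
    \<comment> \<open>The choice starts at \<open>0\<close>, so \<open>f k\<close> belongs to the
      condition for \<open>Suc k\<close>, and the sequence sought is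
      \<open>f (k - 1)\<close>.\<close>
    have "\<exists>f. \<forall>k. (good (Suc k) (f k) \<and> 1 \<le> f k) \<and> f k < f (Suc k)"
    proof (rule dependent_nat_choice)
      show "\<exists>N. good (Suc 0) N \<and> 1 \<le> N" using ex_good[of "Suc 0" 1] by auto
      show "\<exists>N'. (good (Suc (Suc k)) N' \<and> 1 \<le> N') \<and> N < N'" for N k
        using ex_good[of "Suc (Suc k)" "Suc N"] by auto
    qed
    then obtain f where f: "\<And>k. good (Suc k) (f k)" "\<And>k. 1 \<le> f k" "\<And>k. f k < f (Suc k)" by blast
    have "strict_mono f" using f(3) by (simp add: strict_mono_Suc_iff)
    then have "f (k - 1) < f (k' - 1)" if "1 \<le> k" "k < k'" for k k'
      using that strict_monoD[of f "k - 1" "k' - 1"] by simp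
    then have "strict_mono_on {1..} (\<lambda>k. f (k - 1))"
      by (intro strict_mono_onI) simp
    moreover have "\<forall>k\<ge>1. 1 \<le> f (k - 1)" using f(2) by blast
    moreover have "\<forall>k\<ge>1. good k (f (k - 1))"
    proof (intro allI impI)
      fix k :: nat assume "1 \<le> k"
      then show "good k (f (k - 1))" using f(1)[of "k - 1"] by simp
    qed
    ultimately show ?condition
      unfolding good_def using m by blast
  next
    assume ?condition
    then obtain m and N :: "nat \<Rightarrow> nat" where m: "m \<ge> 1" and N: "strict_mono_on {1..} N" "\<forall>k\<ge>1. 1 \<le> N k"
      and cond: "\<And>k. k \<ge> 1 \<Longrightarrow> \<exists>r\<ge>1. \<exists>(i :: nat \<Rightarrow> nat) (b :: nat \<Rightarrow> 'a).
          (\<forall>j\<in>{1..r}. 1 \<le> i j \<and> b j \<noteq> 0) \<and>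
          (let y = (\<Sum>j=1..r. seq_scale (b j) (canonical_vec (i j)));
               q = p (if k \<le> m then m else k)
           in q y \<noteq> 0 \<and>
              real (card {n\<in>{1..N k}.
                 p m (\<Sum>j=1..r. seq_scale (b j * (\<Prod>t=1..n. w (i j - t)))
                                  (canonical_vec (i j - n))) / q y > real k})
                > (1 - 1 / real k) * real (N k))"
      by blast
    \<comment> \<open>This makes the given lengths exceed any prescribed \<open>K\<close>.\<close>
    have N_ge: "k \<le> N k" if "k \<ge> 1" for k
      using that
    proof (induction rule: dec_induct)
      case (step n)
      then have "N n < N (Suc n)" using N(1) by (auto dest: strict_mono_onD)
      with step show ?case by simp
    qed (use N in auto)
    have "\<exists>x. distributionally_irregular m x"
    proof (rule escaping_vectors_imp_irregular[OF m])
      fix K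
      \<comment> \<open>Beyond \<open>m\<close> the prescribed seminorm is \<open>p k\<close>, as in
        the gluing lemma.\<close>
      define k where "k = K + m + 1"
      have k: "k \<ge> 1" "\<not> k \<le> m" by (auto simp: k_def)
      obtain r and i :: "nat \<Rightarrow> nat" and b :: "nat \<Rightarrow> 'a" where
        y: "p k (\<Sum>j=1..r. seq_scale (b j) (canonical_vec (i j))) \<noteq> 0"
        and card: "real (card {n\<in>{1..N k}. p m ((?B ^^ n) (\<Sum>j=1..r. seq_scale (b j) (canonical_vec (i j))))
            / p k (\<Sum>j=1..r. seq_scale (b j) (canonical_vec (i j))) > real k}) > (1 - 1 / real k) * real (N k)"
        using cond[OF k(1)] k(2) unfolding Let_def pow_sum_e[symmetric] by auto
      \<comment> \<open>The sum of the indices is a crude bound for each of them. From then on every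
        summand is a multiple of \<open>canonical_vec 0\<close>, which is zero.\<close>
      have "\<forall>n\<ge>(\<Sum>j=1..r. i j). (?B ^^ n) (\<Sum>j=1..r. seq_scale (b j) (canonical_vec (i j))) = 0"
      proof (intro allI impI)
        fix n assume n: "n \<ge> (\<Sum>j=1..r. i j)"
        have "i j \<le> n" if "j \<in> {1..r}" for j using member_le_sum[OF that, of i] n by simp
        then show "(?B ^^ n) (\<Sum>j=1..r. seq_scale (b j) (canonical_vec (i j))) = 0"
          unfolding pow_sum_e by (intro sum.neutral) auto
      qed
      then show "\<exists>k\<ge>K. \<exists>N\<ge>K. \<exists>y\<in>X. \<exists>S. (\<forall>n\<ge>S. (?B ^^ n) y = 0) \<and> p k y \<noteq> 0 \<and>
          real (card {n\<in>{1..N}. p m ((?B ^^ n) y) / p k y > real k}) > (1 - 1 / real k) * real N"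
        using y card N_ge[OF k(1)] sum_e_in
        by (intro exI[of _ k] conjI exI[of _ "N k"] bexI[of _ "\<Sum>j=1..r. seq_scale (b j) (canonical_vec (i j))"]
            exI[of _ "\<Sum>j=1..r. i j"]) (auto simp: k_def)
    qed
    then show ?chaotic using distributionally_irregular_imp_chaotic by blast
  }
qed

end
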